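(* Let $d\in\mathbb{N}$, let $\Lambda\subset[0,\infty)$ be an additive semigroup with $0\in\Lambda$, and let $\omega$ be an admissible weight on $\Lambda$. A function $f\in\mathcal{D}(\Lambda,\omega,M_d(\mathbb{BC}))$ has an inverse in $\mathcal{D}(\Lambda,\omega,M_d(\mathbb{BC}))$ if and only if $\overline{\{f(s):s\in\mathcal{H}\}}\subset GL_d(\mathbb{BC})$.
   Context: $\mathcal{H}=\{s\in\mathbb C:\operatorname{Re}s\geq 0\}$. $\mathbb{BC}$ (bicomplex numbers) is the 4-dimensional real commutative algebra with elements $x_1+x_2i+x_3j+x_4k$ ($x_m\in\mathbb R$), where $i^2=j^2=-1$, $ij=ji=k$, $k^2=1$. With $\mathbf e_1=(1+k)/2$, $\mathbf e_2=(1-k)/2$, every $M\in M_d(\mathbb{BC})$ ($d\times d$ bicomplex matrices) is uniquely $M=M_1\mathbf e_1+M_2\mathbf e_2$ with $M_1,M_2\in M_d(\mathbb C_i)$, $\mathbb C_i=\{x+iy:x,y\in\mathbb R\}$; addition and multiplication are componentwise in this representation, and the norm is $\|M\|=\|M_1\|_{op}+\|M_2\|_{op}$. $GL_d(\mathbb{BC})$ is the set of invertible elements of $M_d(\mathbb{BC})$. A weight on $\Lambda$ is $\omega:\Lambda\to[1,\infty)$ with $\omega(0)=1$, $\omega(\lambda_1+\lambda_2)\le\omega(\lambda_1)\omega(\lambda_2)$; admissible if $\lim_{n\to\infty}\omega(n\lambda)^{1/n}=1$ for all $\lambda$. For a unital Banach algebra $\mathcal A$ (real or complex), $\mathcal D(\Lambda,\omega,\mathcal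 A)$ is the set of $f:\mathcal H\to\mathcal A$, $f(s)=\sum_{\lambda\in\Lambda}f_\lambda e^{-\lambda s}$ with $\sum_\lambda\|f_\lambda\|\omega(\lambda)<\infty$, a unital Banach algebra under pointwise multiplication. *)

theory Defs
  imports "HOL-Analysis.Analysis"
begin

text \<open>Bicomplex d x d matrices, represented in the idempotent basis:
  M = M1 e1 + M2 e2 is the pair (M1, M2) of complex d x d matrices.
  The dimension d is the cardinality of the finite index type 'n.\<close>

type_synonym 'n bcmat = "(complex^'n^'n) \<times> (complex^'n^'n)"

definition bc_mult :: "'n::finite bcmat \<Rightarrow> 'n bcmat \<Rightarrow> 'n bcmat" where
  "bc_mult A B = (fst A ** fst B, snd A ** snd B)"

definition bc_one :: "'n::finite bcmat" where
  "bc_one = (mat 1, mat 1)"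

text \<open>Multiplication by a complex scalar c in C_i (c = c e1 + c e2).\<close>
definition bc_scale :: "complex \<Rightarrow> 'n::finite bcmat \<Rightarrow> 'n bcmat" where
  "bc_scale c A = ((\<chi> i j. c * (fst A $ i $ j)), (\<chi> i j. c * (snd A $ i $ j)))"

definition bc_norm :: "'n::finite bcmat \<Rightarrow> real" where
  "bc_norm A = onorm (\<lambda>x. fst A *v x) + onorm (\<lambda>x. snd A *v x)"

definition GL_bc :: "'n::finite bcmat set" where
  "GL_bc = {M. \<exists>N. bc_mult M N = bc_one \<and> bc_mult N M = bc_one}"

definition right_half_plane :: "complex set" where
  "right_half_plane = {s. Re s \<ge> 0}"

definition is_weight :: "real set \<Rightarrow> (real \<Rightarrow> real) \<Rightarrow> bool" where
  "is_weight \<Lambda> \<omega> \<longleftrightarrow> (\<forall>l\<in>\<Lambda>. \<omega> l \<ge> 1) \<and> \<omega> 0 = 1 \<and>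
     (\<forall>l1\<in>\<Lambda>. \<forall>l2\<in>\<Lambda>. \<omega> (l1 + l2) \<le> \<omega> l1 * \<omega> l2)"

definition admissible_weight :: "real set \<Rightarrow> (real \<Rightarrow> real) \<Rightarrow> bool" where
  "admissible_weight \<Lambda> \<omega> \<longleftrightarrow> is_weight \<Lambda> \<omega> \<and>
     (\<forall>l\<in>\<Lambda>. (\<lambda>n. root n (\<omega> (real n * l))) \<longlonglongrightarrow> 1)"

definition in_D :: "real set \<Rightarrow> (real \<Rightarrow> real) \<Rightarrow> (complex \<Rightarrow> 'n::finite bcmat) \<Rightarrow> bool" where
  "in_D \<Lambda> \<omega> f \<longleftrightarrow> (\<exists>c :: real \<Rightarrow> 'n bcmat.
     (\<lambda>l. bc_norm (c l) * \<omega> l) summable_on \<Lambda> \<and>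
     (\<forall>s\<in>right_half_plane. ((\<lambda>l. bc_scale (exp (- (of_real l) * s)) (c l)) has_sum f s) \<Lambda>))"

end

theory Submission
  imports Defs
begin

text \<open>Componentwise and by Cramer's rule, everything reduces to inverting a scalar Dirichlet series
  (the determinant) that is bounded away from zero on the closed half-plane.

  The spectral radius of a scalar series is at most its sup norm on the half-plane: the coefficients of a
  power \<open>p^n\<close> of a Dirichlet polynomial are bounded by \<open>sup |p|^n\<close> (Bohr means), and by admissibility of
  the weight the weights of the frequencies occurring in \<open>p^n\<close> add up to \<open>O(r^n)\<close> for every \<open>r > 1\<close>.
  Hence \<open>1 - g\<close> is invertible as soon as \<open>sup |g| < 1\<close>. So if \<open>h\<close> is invertible and \<open>|h| \<ge> \<delta>\<close>, every
  \<open>h'\<close> with \<open>sup |h - h'| \<le> \<delta> / 2\<close> is invertible. The shifts \<open>s \<mapsto> f (s + t)\<close>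
  are uniformly continuous in \<open>t \<ge> 0\<close>, all satisfy \<open>|f (s + t)| \<ge> \<delta>\<close>, and for large \<open>t\<close> are close to
  a nonzero constant, so finitely many steps lead from an invertible shift back to \<open>f\<close>.\<close>

subsection \<open>Exponential sums\<close>

text \<open>Bohr's mean value formula for the coefficients, averaging over an arithmetic progression whose
  step \<open>1 / B\<close> is so small that distinct frequencies stay distinct modulo \<open>2 \<pi>\<close>.\<close>
lemma bohr_coefficient_bound:
  fixes c :: "real \<Rightarrow> complex"
  assumes fin: "finite G" and y: "y \<in> G"
    and bd: "\<And>t::real. norm (\<Sum>x\<in>G. c x * exp (- (of_real x) * (\<i> * of_real t))) \<le> R"
  shows "norm (c y) \<le> R"
proof -
  \<comment> \<open>\<open>B\<close> exceeds every \<open>\<bar>x - y\<bar>\<close>, so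
    \<open>(x - y) / B\<close> lies strictly between -1 and 1, where 0 is the only multiple of 2 pi.
    The summand 1 keeps \<open>B\<close> positive when \<open>G\<close> contains only
    \<open>y\<close>.\<close>
  define B where "B = (\<Sum>x\<in>G. \<bar>x - y\<bar>) + 1"
  have B: "\<bar>x - y\<bar> < B" if "x \<in> G" for x
    using member_le_sum[OF that _ fin, of "\<lambda>x. \<bar>x - y\<bar>"] by (simp add: B_def)
  have Bpos: "0 < B" using B[OF y] by simp
  define z where "z x = exp (\<i> * of_real ((y - x) / B))" for x
  have z1: "z x \<noteq> 1" if "x \<in> G" "x \<noteq> y" for x
  proof
    assume "z x = 1"
    then obtain n :: int where n: "(y - x) / B = of_int (2 * n) * pi"
      by (auto simp: z_def exp_eq_1)
    have "\<bar>(y - x) / B\<bar> < 1" using B[OF that(1)] Bpos by (simp add: abs_minus_commute)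
    then have "\<bar>of_int (2 * n)\<bar> * pi < 1" by (simp add: n abs_mult)
    moreover have "1 \<le> \<bar>of_int (2 * n)\<bar> * pi" if "n \<noteq> 0"
    proof -
      have "1 \<le> \<bar>2 * n\<bar>" using that by linarith
      then have "(1::real) \<le> \<bar>of_int (2 * n)\<bar>" by linarith
      then show ?thesis using pi_ge_two mult_mono[of 1 "\<bar>of_int (2 * n)\<bar>" 1 pi] by simp
    qed
    ultimately have "n = 0" by linarith
    then show False using n Bpos that(2) by simp
  qed
  have nz: "norm (z x) = 1" for x by (simp add: z_def)
  \<comment> \<open>The mean of \<open>N\<close> samples at \<open>t = n / B\<close>, each turned
    back by the oscillation of frequency \<open>y\<close>. Frequency \<open>x\<close> then
    contributes a geometric sum of ratio \<open>z x\<close>, whose mean tends to 0 unless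
    \<open>x = y\<close>.\<close>
  define A where "A N = (\<Sum>n<N. exp (\<i> * of_real (y * (real n / B))) *
      (\<Sum>x\<in>G. c x * exp (- (of_real x) * (\<i> * of_real (real n / B))))) / of_nat N" for N
  have "A N = (\<Sum>x\<in>G. c x * ((\<Sum>n<N. z x ^ n) / of_nat N))" for N
  proof -
    have "exp (\<i> * of_real (y * (real n / B))) * (c x * exp (- (of_real x) * (\<i> * of_real (real n / B))))
        = c x * z x ^ n" for n x
      by (simp add: z_def exp_of_nat_mult[symmetric] mult_exp_exp) (simp add: field_simps diff_divide_distrib)
    then have "A N = (\<Sum>n<N. \<Sum>x\<in>G. c x * z x ^ n) / of_nat N"
      unfolding A_def sum_distrib_left by (simp only:)
    also have "(\<Sum>n<N. \<Sum>x\<in>G. c x * z x ^ n) = (\<Sum>x\<in>G. c x * (\<Sum>n<N. z x ^ n))"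
      unfolding sum_distrib_left by (rule sum.swap)
    finally show ?thesis
      by (simp only: sum_divide_distrib[where A = G] times_divide_eq_right)
  qed
  moreover have "(\<lambda>N. c x * ((\<Sum>n<N. z x ^ n) / of_nat N)) \<longlonglongrightarrow> (if x = y then c y else 0)"
    if x: "x \<in> G" for x
  proof (cases "x = y")
    case True
    have "\<forall>\<^sub>F N in sequentially. c x * ((\<Sum>n<N. z x ^ n) / of_nat N) = c y"
      using eventually_gt_at_top[of 0] by eventually_elim (use True in \<open>simp add: z_def\<close>)
    then show ?thesis using True by (simp add: tendsto_eventually)
  next
    case False
    have "norm ((\<Sum>n<N. z x ^ n) / of_nat N) \<le> (2 / norm (z x - 1)) * (1 / real N)" for N
    proof -
      have "norm (z x ^ N - 1) \<le> 2"
        using norm_triangle_ineq4[of "z x ^ N" 1] by (simp add: norm_power nz)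
      then show ?thesis
        using z1[OF x False] by (simp add: geometric_sum norm_divide norm_mult divide_right_mono)
    qed
    moreover have "(\<lambda>N. (2 / norm (z x - 1)) * (1 / real N)) \<longlonglongrightarrow> 0"
      using tendsto_mult_right_zero[OF lim_1_over_n] by blast
    ultimately have "(\<lambda>N. (\<Sum>n<N. z x ^ n) / of_nat N) \<longlonglongrightarrow> 0"
      by (rule Lim_null_comparison[OF always_eventually[OF allI]])
    from tendsto_mult_right_zero[OF this] show ?thesis using False by simp
  qed
  ultimately have "A \<longlonglongrightarrow> (\<Sum>x\<in>G. if x = y then c y else 0)"
    by (subst ext[of A]) (assumption, rule tendsto_sum)
  then have lim: "A \<longlonglongrightarrow> c y" using fin y by simp
  \<comment> \<open>This settles the empty mean: division by zero makes \<open>A 0\<close> equal to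
    0.\<close>
  have R0: "0 \<le> R" using order_trans[OF norm_ge_zero bd] .
  have "norm (A N) \<le> R" for N
  proof -
    have "norm (A N) \<le> (\<Sum>n<N. R) / real N"
      unfolding A_def norm_divide norm_of_nat
      by (intro divide_right_mono sum_norm_le of_nat_0_le_iff)
        (simp only: norm_mult norm_exp_i_times mult_1_left bd)
    also have "\<dots> \<le> R" using R0 by (cases "N = 0") auto
    finally show ?thesis .
  qed
  then show ?thesis
    using Lim_bounded[OF tendsto_norm[OF lim]] by blast
qed

text \<open>A finite set that contains all frequencies of the \<open>n\<close>-th power of a
  Dirichlet polynomial with frequencies in \<open>F\<close>. Bounding each multiplicity by
  \<open>n\<close>, rather than their total, makes the index set a box, over which sums of products
  factor.\<close>

definition bounded_combinations :: "real set \<Rightarrow> nat \<Rightarrow> real set" where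
  "bounded_combinations F n = (\<lambda>k. \<Sum>l\<in>F. real (k l) * l) ` (F \<rightarrow>\<^sub>E {..n})"

lemma finite_bounded_combinations: "finite F \<Longrightarrow> finite (bounded_combinations F n)"
  unfolding bounded_combinations_def by (intro finite_imageI finite_PiE) auto

lemma bounded_combinations_add:
  assumes "finite F" "x \<in> bounded_combinations F n" "m \<in> F"
  shows "x + m \<in> bounded_combinations F (Suc n)"
proof -
  obtain k where k: "k \<in> F \<rightarrow>\<^sub>E {..n}" "x = (\<Sum>l\<in>F. real (k l) * l)"
    using assms(2) by (auto simp: bounded_combinations_def)
  define k' where "k' = k(m := Suc (k m))"
  have "k' \<in> F \<rightarrow>\<^sub>E {..Suc n}"
    using k(1) assms(3) by (auto simp: k'_def PiE_iff extensional_def le_Suc_eq)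
  moreover have "(\<Sum>l\<in>F. real (k' l) * l) = x + m"
  proof -
    have "(\<Sum>l\<in>F. real (k' l) * l) = (\<Sum>l\<in>F. real (k l) * l + (if l = m then m else 0))"
      by (rule sum.cong) (auto simp: k'_def algebra_simps)
    then show ?thesis using assms k(2) by (simp add: sum.distrib)
  qed
  ultimately show ?thesis unfolding bounded_combinations_def by (metis (no_types, lifting) imageI)
qed

text \<open>The coefficient at \<open>x\<close> collects the products over all pairs with sum
  \<open>x\<close>. A point of \<open>G'\<close> that is no such sum gets an empty sum, so
  \<open>G'\<close> may be larger than the set of sums.\<close>

lemma exponential_sum_mult:
  fixes c a :: "real \<Rightarrow> complex"
  assumes "finite G" "finite F" "finite G'" and "\<And>x l. x \<in> G \<Longrightarrow> l \<in> F \<Longrightarrow> x + l \<in> G'"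
  shows "\<exists>c'. \<forall>s. (\<Sum>x\<in>G. c x * exp (- (of_real x) * s)) * (\<Sum>l\<in>F. a l * exp (- (of_real l) * s))
     = (\<Sum>x\<in>G'. c' x * exp (- (of_real x) * s))"
proof -
  define S where "S x = {p \<in> G \<times> F. fst p + snd p = x}" for x
  have "(\<Sum>x\<in>G. c x * exp (- (of_real x) * s)) * (\<Sum>l\<in>F. a l * exp (- (of_real l) * s))
     = (\<Sum>x\<in>G'. (\<Sum>p\<in>S x. c (fst p) * a (snd p)) * exp (- (of_real x) * s))" for s
  proof -
    define h where "h p = c (fst p) * a (snd p) * exp (- (of_real (fst p + snd p)) * s)" for p
    have "(\<Sum>x\<in>G. c x * exp (- (of_real x) * s)) * (\<Sum>l\<in>F. a l * exp (- (of_real l) * s)) = sum h (G \<times> F)"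
      unfolding sum_product sum.cartesian_product
      by (rule sum.cong) (auto simp: h_def ring_distribs exp_diff exp_minus exp_add field_simps)
    also have "\<dots> = (\<Sum>x\<in>G'. sum h (S x))"
      unfolding S_def using assms by (intro sum.group[symmetric]) auto
    also have "\<dots> = (\<Sum>x\<in>G'. (\<Sum>p\<in>S x. c (fst p) * a (snd p)) * exp (- (of_real x) * s))"
      unfolding sum_distrib_right by (intro sum.cong) (auto simp: h_def S_def)
    finally show ?thesis .
  qed
  then show ?thesis
    by (intro exI[of _ "\<lambda>x. \<Sum>p\<in>S x. c (fst p) * a (snd p)"]) simp
qed

lemma exponential_sum_power:
  fixes a :: "real \<Rightarrow> complex"
  assumes "finite F"
  shows "\<exists>c. \<forall>s. (\<Sum>l\<in>F. a l * exp (- (of_real l) * s)) ^ n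
     = (\<Sum>x\<in>bounded_combinations F n. c x * exp (- (of_real x) * s))"
proof (induction n)
  case 0
  have "F \<rightarrow>\<^sub>E {..0::nat} = {\<lambda>l\<in>F. 0}" by (auto simp: PiE_iff extensional_def fun_eq_iff)
  then have "bounded_combinations F 0 = {0}" by (simp add: bounded_combinations_def)
  then show ?case by (intro exI[of _ "\<lambda>_. 1"]) simp
next
  case (Suc n)
  then obtain c where c: "\<And>s. (\<Sum>l\<in>F. a l * exp (- (of_real l) * s)) ^ n
     = (\<Sum>x\<in>bounded_combinations F n. c x * exp (- (of_real x) * s))" by blast
  show ?case
    unfolding power_Suc2 c
    by (rule exponential_sum_mult) (use assms finite_bounded_combinations bounded_combinations_add in auto)
qed

subsection \<open>Weighted Dirichlet series\<close>

locale weighted_semigroup =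
  fixes \<Lambda> :: "real set" and \<omega> :: "real \<Rightarrow> real"
  assumes nonneg: "\<Lambda> \<subseteq> {0..}" and zero_in: "0 \<in> \<Lambda>"
    and add_in: "a \<in> \<Lambda> \<Longrightarrow> b \<in> \<Lambda> \<Longrightarrow> a + b \<in> \<Lambda>"
    and admissible: "admissible_weight \<Lambda> \<omega>"
begin

abbreviation "H \<equiv> right_half_plane"

text \<open>An upper bound for the weighted norm instead of the norm itself, so that uniqueness of the
  coefficients is never needed.\<close>
definition dirichlet_le :: "real \<Rightarrow> (complex \<Rightarrow> complex) \<Rightarrow> bool" where
  "dirichlet_le M f \<longleftrightarrow> (\<exists>c S. ((\<lambda>l. norm (c l) * \<omega> l) has_sum S) \<Lambda> \<and> S \<le> M \<and>
     (\<forall>s\<in>H. ((\<lambda>l. c l * exp (- (of_real l) * s)) has_sum f s) \<Lambda>))"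

lemma weight_ge_1: "l \<in> \<Lambda> \<Longrightarrow> 1 \<le> \<omega> l"
  and weight_0: "\<omega> 0 = 1"
  and weight_add: "a \<in> \<Lambda> \<Longrightarrow> b \<in> \<Lambda> \<Longrightarrow> \<omega> (a + b) \<le> \<omega> a * \<omega> b"
  and weight_root: "l \<in> \<Lambda> \<Longrightarrow> (\<lambda>n. root n (\<omega> (real n * l))) \<longlonglongrightarrow> 1"
  using admissible by (auto simp: admissible_weight_def is_weight_def)

lemma multiple_in: "l \<in> \<Lambda> \<Longrightarrow> real n * l \<in> \<Lambda>"
  by (induction n) (auto simp: zero_in algebra_simps intro: add_in)

lemma norm_exp_le_1: "l \<in> \<Lambda> \<Longrightarrow> s \<in> H \<Longrightarrow> norm (exp (- (of_real l) * s)) \<le> 1"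
  using nonneg by (auto simp: right_half_plane_def)

lemma weight_nonneg: "l \<in> \<Lambda> \<Longrightarrow> 0 \<le> \<omega> l"
  using weight_ge_1[of l] by linarith

lemma weighted_norm_nonneg: "l \<in> \<Lambda> \<Longrightarrow> 0 \<le> norm (a :: complex) * \<omega> l"
  by (simp add: weight_nonneg)

lemma norm_le_weighted: "l \<in> \<Lambda> \<Longrightarrow> norm (a :: complex) \<le> norm a * \<omega> l"
  using mult_left_mono[OF weight_ge_1, of l "norm a"] by simp

lemma norm_term_le:
  assumes "l \<in> \<Lambda>" "s \<in> H"
  shows "norm (a * exp (- (of_real l) * s)) \<le> norm a"
  unfolding norm_mult using norm_exp_le_1[OF assms] mult_left_le[OF _ norm_ge_zero] by blast

text \<open>The common tool for showing that a function is a Dirichlet series: frequencies may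
  repeat over an arbitrary index set \<open>J\<close>, and terms of equal frequency are collected
  afterwards. Absolute convergence allows summing each fibre of \<open>l\<close> first, and the
  triangle inequality inside a fibre does not increase the weighted norm. Sums, products, infinite
  sums, tails and shifts are instances.\<close>

lemma dirichlet_le_regroup:
  assumes l: "\<And>j. j \<in> J \<Longrightarrow> l j \<in> \<Lambda>"
    and b: "(b has_sum M) J" and ab: "\<And>j. j \<in> J \<Longrightarrow> norm (a j) * \<omega> (l j) \<le> b j"
    and f: "\<And>s. s \<in> H \<Longrightarrow> ((\<lambda>j. a j * exp (- (of_real (l j)) * s)) has_sum f s) J"
  shows "dirichlet_le M f"
proof -
  \<comment> \<open>The fibres of \<open>l\<close>; their disjoint union over
    \<open>\<Lambda>\<close> is identified with \<open>J\<close>, and the weight and the exponential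
    are constant on each of them.\<close>
  define B where "B z = {j \<in> J. l j = z}" for z
  have bij: "bij_betw snd (Sigma \<Lambda> B) J"
    by (rule bij_betwI[where g = "\<lambda>j. (l j, j)"]) (auto simp: B_def l)
  have sw: "(\<lambda>j. norm (a j) * \<omega> (l j)) summable_on J"
    by (rule summable_on_comparison_test[OF has_sum_imp_summable[OF b] ab weighted_norm_nonneg[OF l]])
  define S where "S = infsum (\<lambda>j. norm (a j) * \<omega> (l j)) J"
  have S: "((\<lambda>j. norm (a j) * \<omega> (l j)) has_sum S) J"
    unfolding S_def using sw by simp
  have "S \<le> M" by (rule has_sum_mono[OF S b ab])
  have abs: "(\<lambda>j. norm (a j)) summable_on J"
    by (rule summable_on_comparison_test[OF sw norm_le_weighted[OF l] norm_ge_zero])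
  have absB: "(\<lambda>j. norm (a j)) summable_on B z" for z
    using summable_on_subset_banach[OF abs] by (auto simp: B_def)
  define c where "c z = infsum a (B z)" for z
  define G where "G z = infsum (\<lambda>j. norm (a j)) (B z)" for z
  have c: "(a has_sum c z) (B z)" for z
    using abs_summable_summable[OF absB] by (auto simp: c_def)
  have G: "((\<lambda>j. norm (a j)) has_sum G z) (B z)" for z
    using absB by (auto simp: G_def)
  have "norm (c z) \<le> G z" for z
    by (rule norm_has_sum_bound[OF G c])
  then have cG: "norm (c z) * \<omega> z \<le> G z * \<omega> z" if "z \<in> \<Lambda>" for z
    using weight_ge_1[OF that] by (simp add: mult_right_mono)
  have SG: "((\<lambda>z. G z * \<omega> z) has_sum S) \<Lambda>"
  proof (rule has_sum_SigmaD[where B = B and f = "\<lambda>p. norm (a (snd p)) * \<omega> (l (snd p))"])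
    show "((\<lambda>p. norm (a (snd p)) * \<omega> (l (snd p))) has_sum S) (Sigma \<Lambda> B)"
      using has_sum_reindex_bij_betw[OF bij, of "\<lambda>j. norm (a j) * \<omega> (l j)"] S by simp
    show "((\<lambda>y. norm (a (snd (z, y))) * \<omega> (l (snd (z, y)))) has_sum G z * \<omega> z) (B z)" for z
      using has_sum_cmult_left[OF G, of "\<omega> z"]
      by (subst has_sum_cong[where g = "\<lambda>j. norm (a j) * \<omega> z"]) (auto simp: B_def)
  qed
  have cw: "(\<lambda>z. norm (c z) * \<omega> z) summable_on \<Lambda>"
    by (rule summable_on_comparison_test[OF has_sum_imp_summable[OF SG] cG weighted_norm_nonneg])
  define S' where "S' = infsum (\<lambda>z. norm (c z) * \<omega> z) \<Lambda>"
  have S': "((\<lambda>z. norm (c z) * \<omega> z) has_sum S') \<Lambda>"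
    unfolding S'_def using cw by simp
  have "S' \<le> S"
    by (rule has_sum_mono[OF S' SG cG])
  have "((\<lambda>z. c z * exp (- (of_real z) * s)) has_sum f s) \<Lambda>" if "s \<in> H" for s
  proof (rule has_sum_SigmaD[where B = B and f = "\<lambda>p. a (snd p) * exp (- (of_real (l (snd p))) * s)"])
    show "((\<lambda>p. a (snd p) * exp (- (of_real (l (snd p))) * s)) has_sum f s) (Sigma \<Lambda> B)"
      using has_sum_reindex_bij_betw[OF bij, of "\<lambda>j. a j * exp (- (of_real (l j)) * s)"] f[OF that] by simp
    show "((\<lambda>y. a (snd (z, y)) * exp (- (of_real (l (snd (z, y)))) * s)) has_sum c z * exp (- (of_real z) * s)) (B z)" for z
      using has_sum_cmult_left[OF c, of "exp (- (of_real z) * s)"]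
      by (subst has_sum_cong[where g = "\<lambda>j. a j * exp (- (of_real z) * s)"]) (auto simp: B_def)
  qed
  then show ?thesis
    unfolding dirichlet_le_def using S' \<open>S' \<le> S\<close> \<open>S \<le> M\<close> by (intro exI[of _ c] exI[of _ S']) auto
qed

text \<open>The weighted norm dominates the sup norm on \<open>H\<close>, because weights are at
  least 1 and the exponentials there have modulus at most 1.\<close>

lemma dirichlet_le_bound:
  assumes "dirichlet_le M f" "s \<in> H"
  shows "norm (f s) \<le> M"
proof -
  obtain c S where c: "((\<lambda>l. norm (c l) * \<omega> l) has_sum S) \<Lambda>" "S \<le> M"
    and f: "((\<lambda>l. c l * exp (- (of_real l) * s)) has_sum f s) \<Lambda>"
    using assms unfolding dirichlet_le_def by blast
  have le: "norm (c l * exp (- (of_real l) * s)) \<le> norm (c l) * \<omega> l" if "l \<in> \<Lambda>" for l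
    using order_trans[OF norm_term_le[OF that assms(2)] norm_le_weighted[OF that]] .
  have "(\<lambda>l. norm (c l * exp (- (of_real l) * s))) summable_on \<Lambda>"
    by (rule summable_on_comparison_test[OF has_sum_imp_summable[OF c(1)] le]) auto
  then have s: "((\<lambda>l. norm (c l * exp (- (of_real l) * s))) has_sum
      infsum (\<lambda>l. norm (c l * exp (- (of_real l) * s))) \<Lambda>) \<Lambda>" by simp
  show ?thesis
    using norm_has_sum_bound[OF s f] has_sum_mono[OF s c(1) le] c(2) by linarith
qed

lemma dirichlet_le_cong:
  "dirichlet_le M f \<Longrightarrow> (\<And>s. s \<in> H \<Longrightarrow> f s = g s) \<Longrightarrow> dirichlet_le M g"
  unfolding dirichlet_le_def by simp

lemma dirichlet_le_mono: "dirichlet_le M f \<Longrightarrow> M \<le> N \<Longrightarrow> dirichlet_le N f"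
  unfolding dirichlet_le_def by (blast intro: order_trans)

lemma dirichlet_le_finite:
  assumes "finite J" "\<And>j. j \<in> J \<Longrightarrow> l j \<in> \<Lambda>"
  shows "dirichlet_le (\<Sum>j\<in>J. norm (a j) * \<omega> (l j)) (\<lambda>s. \<Sum>j\<in>J. a j * exp (- (of_real (l j)) * s))"
  by (rule dirichlet_le_regroup[OF assms(2) has_sum_finite[OF assms(1)] order_refl has_sum_finite[OF assms(1)]])

lemma dirichlet_le_const: "dirichlet_le (norm a) (\<lambda>s. a)"
  using dirichlet_le_finite[of "{0}" "\<lambda>_. 0" "\<lambda>_. a"] by (simp add: zero_in weight_0)

lemma dirichlet_le_add:
  assumes "dirichlet_le M f" "dirichlet_le N g"
  shows "dirichlet_le (M + N) (\<lambda>s. f s + g s)"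
proof -
  obtain c S where c: "((\<lambda>l. norm (c l) * \<omega> l) has_sum S) \<Lambda>" "S \<le> M"
    and f: "\<And>s. s \<in> H \<Longrightarrow> ((\<lambda>l. c l * exp (- (of_real l) * s)) has_sum f s) \<Lambda>"
    using assms unfolding dirichlet_le_def by blast
  obtain d T where d: "((\<lambda>l. norm (d l) * \<omega> l) has_sum T) \<Lambda>" "T \<le> N"
    and g: "\<And>s. s \<in> H \<Longrightarrow> ((\<lambda>l. d l * exp (- (of_real l) * s)) has_sum g s) \<Lambda>"
    using assms unfolding dirichlet_le_def by blast
  have "dirichlet_le (S + T) (\<lambda>s. f s + g s)"
  proof (rule dirichlet_le_regroup[where J = \<Lambda> and l = "\<lambda>l. l" and a = "\<lambda>l. c l + d l"])
    show "((\<lambda>l. norm (c l) * \<omega> l + norm (d l) * \<omega> l) has_sum (S + T)) \<Lambda>"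
      by (intro has_sum_add c d)
    show "norm (c l + d l) * \<omega> l \<le> norm (c l) * \<omega> l + norm (d l) * \<omega> l" if "l \<in> \<Lambda>" for l
      using weight_ge_1[OF that] norm_triangle_ineq[of "c l" "d l"]
      by (simp flip: distrib_right add: mult_right_mono)
    show "((\<lambda>l. (c l + d l) * exp (- (of_real l) * s)) has_sum f s + g s) \<Lambda>" if "s \<in> H" for s
      using has_sum_add[OF f[OF that] g[OF that]] by (simp add: distrib_right)
  qed
  then show ?thesis by (rule dirichlet_le_mono) (use c d in linarith)
qed

text \<open>The Cauchy product, indexed by pairs of frequencies. Submultiplicativity of the weight
  bounds its weighted sum by the product of the two weighted sums.\<close>

lemma dirichlet_le_mult:
  assumes "dirichlet_le M f" "dirichlet_le N g"
  shows "dirichlet_le (M * N) (\<lambda>s. f s * g s)"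
proof -
  obtain c S where c: "((\<lambda>l. norm (c l) * \<omega> l) has_sum S) \<Lambda>" "S \<le> M"
    and f: "\<And>s. s \<in> H \<Longrightarrow> ((\<lambda>l. c l * exp (- (of_real l) * s)) has_sum f s) \<Lambda>"
    using assms unfolding dirichlet_le_def by blast
  obtain d T where d: "((\<lambda>l. norm (d l) * \<omega> l) has_sum T) \<Lambda>" "T \<le> N"
    and g: "\<And>s. s \<in> H \<Longrightarrow> ((\<lambda>l. d l * exp (- (of_real l) * s)) has_sum g s) \<Lambda>"
    using assms unfolding dirichlet_le_def by blast
  define b where "b p = (norm (c (fst p)) * \<omega> (fst p)) * (norm (d (snd p)) * \<omega> (snd p))" for p
  have inner: "((\<lambda>y. b (x, y)) has_sum (norm (c x) * \<omega> x) * T) \<Lambda>" for x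
    unfolding b_def fst_conv snd_conv by (rule has_sum_cmult_right[OF d(1)])
  have outer: "((\<lambda>x. (norm (c x) * \<omega> x) * T) has_sum S * T) \<Lambda>"
    by (rule has_sum_cmult_left[OF c(1)])
  have "b summable_on \<Lambda> \<times> \<Lambda>"
    by (rule summable_on_SigmaI[OF inner has_sum_imp_summable[OF outer]]) (auto simp: b_def intro!: mult_nonneg_nonneg weighted_norm_nonneg)
  then have b: "(b has_sum S * T) (\<Lambda> \<times> \<Lambda>)"
    using has_sum_SigmaI[OF inner outer] by auto
  have le: "norm (c (fst p) * d (snd p)) * \<omega> (fst p + snd p) \<le> b p" if "p \<in> \<Lambda> \<times> \<Lambda>" for p
    using mult_left_mono[OF weight_add[of "fst p" "snd p"], of "norm (c (fst p) * d (snd p))"] that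
    by (auto simp: b_def norm_mult mult_ac)
  have "dirichlet_le (S * T) (\<lambda>s. f s * g s)"
  proof (rule dirichlet_le_regroup[where J = "\<Lambda> \<times> \<Lambda>" and l = "\<lambda>p. fst p + snd p" and a = "\<lambda>p. c (fst p) * d (snd p)"])
    show "(b has_sum S * T) (\<Lambda> \<times> \<Lambda>)" by fact
    show "fst p + snd p \<in> \<Lambda>" if "p \<in> \<Lambda> \<times> \<Lambda>" for p using that add_in by auto
    fix s assume s: "s \<in> H"
    define t where "t p = c (fst p) * d (snd p) * exp (- of_real (fst p + snd p) * s)" for p
    have t: "t p = (c (fst p) * exp (- of_real (fst p) * s)) * (d (snd p) * exp (- of_real (snd p) * s))" for p
      by (simp add: t_def exp_add[symmetric] ring_distribs)
    have "t summable_on \<Lambda> \<times> \<Lambda>"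
    proof (rule abs_summable_summable, rule summable_on_comparison_test[OF has_sum_imp_summable[OF b]])
      fix p assume p: "p \<in> \<Lambda> \<times> \<Lambda>"
      have "fst p + snd p \<in> \<Lambda>" using p add_in by auto
      from norm_term_le[OF this s, of "c (fst p) * d (snd p)"] norm_le_weighted[OF this, of "c (fst p) * d (snd p)"] le[OF p]
      show "norm (t p) \<le> b p" unfolding t_def by linarith
    qed auto
    moreover have "((\<lambda>y. t (x, y)) has_sum (c x * exp (- of_real x * s)) * g s) \<Lambda>" for x
      unfolding t fst_conv snd_conv by (rule has_sum_cmult_right[OF g[OF s]])
    moreover have "((\<lambda>x. (c x * exp (- of_real x * s)) * g s) has_sum f s * g s) \<Lambda>"
      by (rule has_sum_cmult_left[OF f[OF s]])
    ultimately have "(t has_sum f s * g s) (\<Lambda> \<times> \<Lambda>)"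
      by (intro has_sum_SigmaI)
    then show "((\<lambda>p. c (fst p) * d (snd p) * exp (- of_real (fst p + snd p) * s)) has_sum f s * g s) (\<Lambda> \<times> \<Lambda>)"
      unfolding t_def .
  qed (use le in auto)
  \<comment> \<open>Signs are needed to pass from \<open>S \<le> M\<close> and
    \<open>T \<le> N\<close> to the product of the bounds.\<close>
  moreover have "0 \<le> S" using has_sum_nonneg[OF c(1)] weighted_norm_nonneg by auto
  moreover have "0 \<le> T" using has_sum_nonneg[OF d(1)] weighted_norm_nonneg by auto
  ultimately show ?thesis
    using c(2) d(2) by (auto elim!: dirichlet_le_mono intro!: mult_mono)
qed

lemma dirichlet_le_cmult: "dirichlet_le M f \<Longrightarrow> dirichlet_le (norm a * M) (\<lambda>s. a * f s)"
  by (rule dirichlet_le_mult[OF dirichlet_le_const])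

lemma dirichlet_le_power:
  assumes "dirichlet_le M f"
  shows "dirichlet_le (M ^ n) (\<lambda>s. f s ^ n)"
proof (induction n)
  case 0
  show ?case using dirichlet_le_const[of 1] by simp
next
  case (Suc n)
  show ?case using dirichlet_le_mult[OF assms Suc] by simp
qed

lemma dirichlet_le_sum:
  assumes "finite I" "\<And>i. i \<in> I \<Longrightarrow> dirichlet_le (M i) (f i)"
  shows "dirichlet_le (sum M I) (\<lambda>s. \<Sum>i\<in>I. f i s)"
  using assms
proof (induction I rule: finite_induct)
  case empty
  show ?case using dirichlet_le_const[of 0] by simp
next
  case (insert i I)
  have "dirichlet_le (sum M I) (\<lambda>s. \<Sum>i\<in>I. f i s)"
    by (rule insert.IH) (rule insert.prems, simp)
  from dirichlet_le_add[OF insert.prems[OF insertI1] this]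
  show ?case by (simp only: sum.insert[OF insert.hyps])
qed

text \<open>Completeness in the form that the Neumann series requires: the coefficients of all
  \<open>f n\<close> together form an absolutely summable family over pairs of \<open>n\<close> and
  a frequency, which is regrouped by frequency.\<close>

lemma dirichlet_le_suminf:
  assumes f: "\<And>n. dirichlet_le (M n) (f n)" and M: "summable M"
  shows "dirichlet_le (suminf M) (\<lambda>s. \<Sum>n. f n s)"
proof -
  have "\<forall>n. \<exists>c S. ((\<lambda>l. norm (c l) * \<omega> l) has_sum S) \<Lambda> \<and> S \<le> M n \<and>
     (\<forall>s\<in>H. ((\<lambda>l. c l * exp (- (of_real l) * s)) has_sum f n s) \<Lambda>)"
    using f unfolding dirichlet_le_def by blast
  then obtain c where "\<forall>n. \<exists>S. ((\<lambda>l. norm (c n l) * \<omega> l) has_sum S) \<Lambda> \<and> S \<le> M n \<and>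
     (\<forall>s\<in>H. ((\<lambda>l. c n l * exp (- (of_real l) * s)) has_sum f n s) \<Lambda>)"
    by (rule choice[THEN exE])
  then obtain S where "\<forall>n. ((\<lambda>l. norm (c n l) * \<omega> l) has_sum S n) \<Lambda> \<and> S n \<le> M n \<and>
     (\<forall>s\<in>H. ((\<lambda>l. c n l * exp (- (of_real l) * s)) has_sum f n s) \<Lambda>)"
    by (rule choice[THEN exE])
  then have c: "\<And>n. ((\<lambda>l. norm (c n l) * \<omega> l) has_sum S n) \<Lambda>" and SM: "\<And>n. S n \<le> M n"
    and fs: "\<And>n s. s \<in> H \<Longrightarrow> ((\<lambda>l. c n l * exp (- (of_real l) * s)) has_sum f n s) \<Lambda>"
    by blast+
  have S0: "0 \<le> S n" for n using has_sum_nonneg[OF c] weighted_norm_nonneg by auto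
  have sS: "summable S" by (rule summable_comparison_test'[OF M]) (use S0 SM in auto)
  then have S: "(S has_sum suminf S) UNIV"
    using S0 by (intro norm_summable_imp_has_sum) (auto simp: summable_sums)
  define b where "b p = norm (c (fst p) (snd p)) * \<omega> (snd p)" for p
  have inner: "((\<lambda>l. b (n, l)) has_sum S n) \<Lambda>" for n
    using c by (simp add: b_def)
  have "b summable_on UNIV \<times> \<Lambda>"
    by (rule summable_on_SigmaI[OF inner has_sum_imp_summable[OF S]]) (auto simp: b_def intro!: weighted_norm_nonneg mult_nonneg_nonneg)
  then have b: "(b has_sum suminf S) (UNIV \<times> \<Lambda>)"
    using has_sum_SigmaI[OF inner S] by auto
  have "dirichlet_le (suminf S) (\<lambda>s. \<Sum>n. f n s)"
  proof (rule dirichlet_le_regroup[where J = "UNIV \<times> \<Lambda>" and l = snd and a = "\<lambda>p. c (fst p) (snd p)"])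
    show "(b has_sum suminf S) (UNIV \<times> \<Lambda>)" by fact
    fix s assume s: "s \<in> H"
    define t where "t p = c (fst p) (snd p) * exp (- of_real (snd p) * s)" for p
    have "t summable_on UNIV \<times> \<Lambda>"
    proof (rule abs_summable_summable, rule summable_on_comparison_test[OF has_sum_imp_summable[OF b]])
      fix p assume p: "p \<in> (UNIV :: nat set) \<times> \<Lambda>"
      have "snd p \<in> \<Lambda>" using p by auto
      from norm_term_le[OF this s, of "c (fst p) (snd p)"] norm_le_weighted[OF this, of "c (fst p) (snd p)"]
      show "norm (t p) \<le> b p" unfolding t_def b_def by linarith
    qed auto
    moreover have "summable (\<lambda>n. norm (f n s))"
      by (rule summable_comparison_test'[OF M]) (use dirichlet_le_bound[OF f s] in auto)
    then have "((\<lambda>n. f n s) has_sum (\<Sum>n. f n s)) UNIV"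
      by (rule norm_summable_imp_has_sum) (rule summable_sums[OF summable_norm_cancel], fact)
    ultimately have "(t has_sum (\<Sum>n. f n s)) (UNIV \<times> \<Lambda>)"
      by (intro has_sum_SigmaI[where g = "\<lambda>n. f n s"]) (auto simp: t_def fs[OF s, simplified])
    then show "((\<lambda>p. c (fst p) (snd p) * exp (- of_real (snd p) * s)) has_sum (\<Sum>n. f n s)) (UNIV \<times> \<Lambda>)"
      unfolding t_def .
  qed (auto simp: b_def)
  then show ?thesis by (rule dirichlet_le_mono) (rule suminf_le[OF SM sS M])
qed

subsection \<open>Spectral radius\<close>

text \<open>For \<open>1 < q < r\<close>, admissibility gives
  \<open>\<omega> (real j * l) \<le> q ^ j\<close> for large \<open>j\<close>, so the weights
  divided by \<open>r ^ j\<close> are summable. Their sum serves as \<open>C\<close>, since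
  \<open>r ^ j \<le> r ^ n\<close> for \<open>j \<le> n\<close>.\<close>

lemma weight_multiples_growth:
  assumes l: "l \<in> \<Lambda>" and r: "1 < r"
  shows "\<exists>C\<ge>0. \<forall>n. (\<Sum>j\<le>n. \<omega> (real j * l)) \<le> C * r ^ n"
proof -
  define q where "q = (1 + r) / 2"
  have q: "1 < q" "q < r" using r by (auto simp: q_def)
  have pos: "0 \<le> \<omega> (real j * l)" for j
    using weight_ge_1[OF multiple_in[OF l], of j] by linarith
  have "\<forall>\<^sub>F n in sequentially. root n (\<omega> (real n * l)) < q"
    using order_tendstoD(2)[OF weight_root[OF l] q(1)] .
  then have "\<forall>\<^sub>F n in sequentially. norm (\<omega> (real n * l) / r ^ n) \<le> (q / r) ^ n"
    using eventually_gt_at_top[of 0]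
  proof eventually_elim
    case (elim n)
    have "\<omega> (real n * l) = root n (\<omega> (real n * l)) ^ n" using elim pos by simp
    also have "\<dots> \<le> q ^ n" using elim pos by (intro power_mono) auto
    finally show ?case using pos r by (simp add: power_divide divide_right_mono)
  qed
  then have sm: "summable (\<lambda>n. \<omega> (real n * l) / r ^ n)"
    by (rule summable_comparison_test_ev) (use q in \<open>auto intro!: summable_geometric\<close>)
  define C where "C = (\<Sum>n. \<omega> (real n * l) / r ^ n)"
  have "0 \<le> C" unfolding C_def using sm pos r by (intro suminf_nonneg) auto
  moreover have "(\<Sum>j\<le>n. \<omega> (real j * l)) \<le> C * r ^ n" for n
  proof -
    have "(\<Sum>j\<le>n. \<omega> (real j * l)) \<le> (\<Sum>j\<le>n. \<omega> (real j * l) / r ^ j * r ^ n)"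
    proof (rule sum_mono)
      fix j assume "j \<in> {..n}"
      then have "r ^ j \<le> r ^ n" using r by (intro power_increasing) auto
      then show "\<omega> (real j * l) \<le> \<omega> (real j * l) / r ^ j * r ^ n"
        using mult_left_mono[OF _ pos, of "r ^ j" "r ^ n" j] r by (simp add: field_simps)
    qed
    also have "\<dots> = (\<Sum>j\<le>n. \<omega> (real j * l) / r ^ j) * r ^ n" by (simp add: sum_distrib_right)
    also have "\<dots> \<le> C * r ^ n"
      unfolding C_def using sm pos r by (intro mult_right_mono sum_le_suminf) auto
    finally show ?thesis .
  qed
  ultimately show ?thesis by blast
qed

lemma combination_in:
  assumes "finite F" "F \<subseteq> \<Lambda>"
  shows "(\<Sum>l\<in>F. real (k l) * l) \<in> \<Lambda>" and "\<omega> (\<Sum>l\<in>F. real (k l) * l) \<le> (\<Prod>l\<in>F. \<omega> (real (k l) * l))"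
  using assms
proof (induction F rule: finite_induct)
  case empty
  { case 1 show ?case by (simp add: zero_in) }
  { case 2 show ?case by (simp add: weight_0) }
next
  case (insert m F)
  have m: "real (k m) * m \<in> \<Lambda>" if "insert m F \<subseteq> \<Lambda>" using that multiple_in by auto
  { case 1 show ?case using insert 1 m add_in by simp }
  { case 2
    have "\<omega> (real (k m) * m + (\<Sum>l\<in>F. real (k l) * l)) \<le> \<omega> (real (k m) * m) * \<omega> (\<Sum>l\<in>F. real (k l) * l)"
      using 2 insert.IH(1) m by (intro weight_add) auto
    also have "\<dots> \<le> \<omega> (real (k m) * m) * (\<Prod>l\<in>F. \<omega> (real (k l) * l))"
      using 2 insert.IH(2) weight_ge_1[OF m] by (intro mult_left_mono) auto
    finally show ?case using insert.hyps by simp }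
qed

text \<open>The weight of a combination is at most the product of the weights of its parts, so the
  sum over the box of multiplicities is bounded by a product of sums over the multiples of a single
  generator.\<close>

lemma weight_bounded_combinations_growth:
  assumes F: "finite F" "F \<subseteq> \<Lambda>" and r: "1 < r"
  shows "\<exists>C. \<forall>n. (\<Sum>x\<in>bounded_combinations F n. \<omega> x) \<le> C * r ^ n"
proof -
  \<comment> \<open>Each generator gets growth rate \<open>\<rho>\<close>, and the
    \<open>card F\<close> factors together stay below \<open>r\<close>. The successor makes the
    index of the root positive when \<open>F\<close> is empty.\<close>
  define \<rho> where "\<rho> = root (Suc (card F)) r"
  have \<rho>: "1 < \<rho>" "\<rho> ^ Suc (card F) = r" using r by (simp_all add: \<rho>_def del: power_Suc)
  have "\<rho> ^ card F \<le> \<rho> ^ Suc (card F)" using \<rho>(1) by (intro power_increasing) auto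
  then have \<rho>r: "\<rho> ^ card F \<le> r" using \<rho>(2) by simp
  have "\<forall>l\<in>F. \<exists>C\<ge>0. \<forall>n. (\<Sum>j\<le>n. \<omega> (real j * l)) \<le> C * \<rho> ^ n"
    using F(2) weight_multiples_growth[OF _ \<rho>(1)] by blast
  then obtain C where C: "\<And>l. l \<in> F \<Longrightarrow> 0 \<le> C l"
    and Cn: "\<And>l n. l \<in> F \<Longrightarrow> (\<Sum>j\<le>n. \<omega> (real j * l)) \<le> C l * \<rho> ^ n"
    by (auto dest!: bchoice)
  have "(\<Sum>x\<in>bounded_combinations F n. \<omega> x) \<le> (\<Prod>l\<in>F. C l) * r ^ n" for n
  proof -
    have pos: "0 \<le> \<omega> x" if "x \<in> \<Lambda>" for x using weight_ge_1[OF that] by linarith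
    \<comment> \<open>Only an inequality, since different multiplicities can give the same
      frequency.\<close>
    have "(\<Sum>x\<in>bounded_combinations F n. \<omega> x) \<le> (\<Sum>k\<in>F \<rightarrow>\<^sub>E {..n}. \<omega> (\<Sum>l\<in>F. real (k l) * l))"
      unfolding bounded_combinations_def
      by (rule order_trans[OF sum_image_le]) (use F combination_in(1) pos in \<open>auto intro!: finite_PiE\<close>)
    also have "\<dots> \<le> (\<Sum>k\<in>F \<rightarrow>\<^sub>E {..n}. \<Prod>l\<in>F. \<omega> (real (k l) * l))"
      by (intro sum_mono combination_in(2) F)
    also have "\<dots> = (\<Prod>l\<in>F. \<Sum>j\<le>n. \<omega> (real j * l))"
      using F by (subst prod_sum_PiE) auto
    also have "\<dots> \<le> (\<Prod>l\<in>F. C l * \<rho> ^ n)"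
      using F Cn pos multiple_in by (intro prod_mono) (auto intro!: sum_nonneg)
    also have "\<dots> = (\<Prod>l\<in>F. C l) * (\<rho> ^ card F) ^ n"
      by (simp add: prod.distrib power_mult[symmetric] mult.commute)
    also have "\<dots> \<le> (\<Prod>l\<in>F. C l) * r ^ n"
      using \<rho>r \<rho>(1) C by (intro mult_left_mono power_mono prod_nonneg) auto
    finally show ?thesis .
  qed
  then show ?thesis by blast
qed

text \<open>On the imaginary axis the \<open>n\<close>-th power is bounded by \<open>R ^ n\<close>,
  hence so is each of its coefficients. The total weight of its possible frequencies contributes the
  factor \<open>C * r ^ n\<close>.\<close>

lemma exponential_sum_power_le:
  assumes F: "finite F" "F \<subseteq> \<Lambda>" and r: "1 < r"
    and bd: "\<And>s. s \<in> H \<Longrightarrow> norm (\<Sum>l\<in>F. a l * exp (- (of_real l) * s)) \<le> R"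
  shows "\<exists>C. \<forall>n. dirichlet_le (C * (R * r) ^ n) (\<lambda>s. (\<Sum>l\<in>F. a l * exp (- (of_real l) * s)) ^ n)"
proof -
  obtain C where C: "\<And>n. (\<Sum>x\<in>bounded_combinations F n. \<omega> x) \<le> C * r ^ n"
    using weight_bounded_combinations_growth[OF F r] by blast
  have R0: "0 \<le> R" using order_trans[OF norm_ge_zero bd[of 0]] by (simp add: right_half_plane_def)
  have "dirichlet_le (C * (R * r) ^ n) (\<lambda>s. (\<Sum>l\<in>F. a l * exp (- (of_real l) * s)) ^ n)" for n
  proof -
    obtain c where c: "\<And>s. (\<Sum>l\<in>F. a l * exp (- (of_real l) * s)) ^ n
       = (\<Sum>x\<in>bounded_combinations F n. c x * exp (- (of_real x) * s))"
      using exponential_sum_power[OF F(1)] by blast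
    note fin = finite_bounded_combinations[OF F(1), of n]
    have sub: "x \<in> \<Lambda>" if "x \<in> bounded_combinations F n" for x
      using that combination_in(1)[OF F] by (auto simp: bounded_combinations_def)
    have cb: "norm (c x) \<le> R ^ n" if "x \<in> bounded_combinations F n" for x
    proof (rule bohr_coefficient_bound[OF fin that])
      fix t :: real
      have "\<i> * of_real t \<in> H" by (simp add: right_half_plane_def)
      from power_mono[OF bd[OF this] norm_ge_zero, of n]
      show "norm (\<Sum>x\<in>bounded_combinations F n. c x * exp (- (of_real x) * (\<i> * of_real t))) \<le> R ^ n"
        unfolding c[symmetric] norm_power .
    qed
    have "(\<Sum>x\<in>bounded_combinations F n. norm (c x) * \<omega> x) \<le> (\<Sum>x\<in>bounded_combinations F n. R ^ n * \<omega> x)"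
      using cb sub weight_ge_1 by (intro sum_mono mult_right_mono) force+
    also have "\<dots> \<le> R ^ n * (C * r ^ n)"
      unfolding sum_distrib_left[symmetric] using C R0 by (intro mult_left_mono) auto
    finally show ?thesis
      unfolding c using dirichlet_le_mono[OF dirichlet_le_finite[OF fin sub]]
      by (simp add: power_mult_distrib mult_ac)
  qed
  then show ?thesis by blast
qed

text \<open>The partial sum over a large finite \<open>F\<close> leaves a tail of small weighted
  norm. As \<open>q\<close> is defined by subtraction, the decomposition holds for every
  \<open>s\<close>, not only in the half-plane.\<close>

lemma dirichlet_le_split:
  assumes "dirichlet_le M f" and \<epsilon>: "0 < \<epsilon>"
  obtains F a q where "finite F" "F \<subseteq> \<Lambda>" "dirichlet_le \<epsilon> q"
    "\<And>s. f s = (\<Sum>l\<in>F. a l * exp (- (of_real l) * s)) + q s"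
proof -
  obtain c S where c: "((\<lambda>l. norm (c l) * \<omega> l) has_sum S) \<Lambda>"
    and f: "\<And>s. s \<in> H \<Longrightarrow> ((\<lambda>l. c l * exp (- (of_real l) * s)) has_sum f s) \<Lambda>"
    using assms unfolding dirichlet_le_def by blast
  obtain F where F: "finite F" "F \<subseteq> \<Lambda>" "dist (\<Sum>l\<in>F. norm (c l) * \<omega> l) S \<le> \<epsilon>"
    using has_sum_finite_approximation[OF c \<epsilon>] by blast
  define q where "q s = f s - (\<Sum>l\<in>F. c l * exp (- (of_real l) * s))" for s
  have "dirichlet_le (S - (\<Sum>l\<in>F. norm (c l) * \<omega> l)) q"
  proof (rule dirichlet_le_regroup[where J = "\<Lambda> - F" and l = "\<lambda>l. l" and a = c])
    show "((\<lambda>l. norm (c l) * \<omega> l) has_sum S - (\<Sum>l\<in>F. norm (c l) * \<omega> l)) (\<Lambda> - F)"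
      by (rule has_sum_Diff[OF c has_sum_finite[OF F(1)] F(2)])
    show "((\<lambda>j. c j * exp (- complex_of_real j * s)) has_sum q s) (\<Lambda> - F)" if "s \<in> H" for s
      unfolding q_def by (rule has_sum_Diff[OF f[OF that] has_sum_finite[OF F(1)] F(2)])
  qed auto
  then have "dirichlet_le \<epsilon> q" by (rule dirichlet_le_mono) (use F(3) in \<open>auto simp: dist_real_def\<close>)
  then show ?thesis by (rule that[OF F(1,2), of q c]) (simp add: q_def)
qed

text \<open>In \<open>(p + q)^n\<close>, with \<open>p\<close> a finite partial sum, the powers of \<open>p\<close> grow like those of its
  sup norm, and the powers of the small remainder \<open>q\<close> are controlled by submultiplicativity.\<close>
lemma dirichlet_le_power_sup:
  assumes f: "dirichlet_le M f" and bd: "\<And>s. s \<in> H \<Longrightarrow> norm (f s) \<le> \<rho>" and r: "\<rho> < r"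
  shows "\<exists>C. \<forall>n. dirichlet_le (C * r ^ n) (\<lambda>s. f s ^ n)"
proof -
  \<comment> \<open>The gap is spent in three equal shares: the sup norm of \<open>p\<close> is at
    most \<open>\<rho> + \<epsilon>\<close>, its powers grow at rate
    \<open>\<rho> + 2 * \<epsilon>\<close>, and the remainder \<open>q\<close> adds the last
    \<open>\<epsilon>\<close>.\<close>
  define \<epsilon> where "\<epsilon> = (r - \<rho>) / 3"
  have \<epsilon>: "0 < \<epsilon>" and r_eq: "r = \<rho> + 2 * \<epsilon> + \<epsilon>" using r by (auto simp: \<epsilon>_def field_simps)
  have \<rho>0: "0 \<le> \<rho>" using order_trans[OF norm_ge_zero bd[of 0]] by (simp add: right_half_plane_def)
  obtain F a q where F: "finite F" "F \<subseteq> \<Lambda>" and q: "dirichlet_le \<epsilon> q"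
    and f_eq: "\<And>s. f s = (\<Sum>l\<in>F. a l * exp (- (of_real l) * s)) + q s"
    by (rule dirichlet_le_split[OF f \<epsilon>]) (rule that)
  define p where "p s = (\<Sum>l\<in>F. a l * exp (- (of_real l) * s))" for s
  have "norm (p s) \<le> \<rho> + \<epsilon>" if "s \<in> H" for s
    using norm_triangle_ineq4[of "f s" "q s"] bd[OF that] dirichlet_le_bound[OF q that]
    by (simp add: f_eq p_def)
  moreover have "1 < (\<rho> + 2 * \<epsilon>) / (\<rho> + \<epsilon>)" using \<epsilon> \<rho>0 by simp
  ultimately have "\<exists>C. \<forall>n. dirichlet_le (C * ((\<rho> + \<epsilon>) * ((\<rho> + 2 * \<epsilon>) / (\<rho> + \<epsilon>))) ^ n) (\<lambda>s. p s ^ n)"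
    unfolding p_def by (intro exponential_sum_power_le[OF F])
  moreover have "(\<rho> + \<epsilon>) * ((\<rho> + 2 * \<epsilon>) / (\<rho> + \<epsilon>)) = \<rho> + 2 * \<epsilon>" using \<epsilon> \<rho>0 by simp
  ultimately obtain C where C: "\<And>n. dirichlet_le (C * (\<rho> + 2 * \<epsilon>) ^ n) (\<lambda>s. p s ^ n)" by auto
  have "dirichlet_le (C * r ^ n) (\<lambda>s. f s ^ n)" for n
  proof -
    \<comment> \<open>Since \<open>C\<close> does not depend on the exponent, the bounds of the
      binomial terms again add up to a binomial expansion, that of \<open>C * r ^ n\<close>.\<close>
    have "dirichlet_le (\<Sum>k\<le>n. norm (of_nat (n choose k) :: complex) * (C * (\<rho> + 2 * \<epsilon>) ^ k * \<epsilon> ^ (n - k)))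
       (\<lambda>s. \<Sum>k\<le>n. of_nat (n choose k) * (p s ^ k * q s ^ (n - k)))"
      by (rule dirichlet_le_sum[OF finite_atMost
            dirichlet_le_cmult[OF dirichlet_le_mult[OF C dirichlet_le_power[OF q]]]])
    moreover have "(\<Sum>k\<le>n. norm (of_nat (n choose k) :: complex) * (C * (\<rho> + 2 * \<epsilon>) ^ k * \<epsilon> ^ (n - k))) = C * r ^ n"
      unfolding r_eq binomial_ring[of "\<rho> + 2 * \<epsilon>" \<epsilon> n] by (simp add: sum_distrib_left mult_ac)
    moreover have "(\<Sum>k\<le>n. of_nat (n choose k) * (p s ^ k * q s ^ (n - k))) = f s ^ n" for s
      unfolding f_eq p_def[symmetric] binomial_ring by (simp add: mult_ac)
    ultimately show ?thesis by simp
  qed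
  then show ?thesis by blast
qed

section \<open>Neumann series and perturbation of invertible series\<close>

definition dirichlet :: "(complex \<Rightarrow> complex) \<Rightarrow> bool" where
  "dirichlet f \<longleftrightarrow> (\<exists>M. dirichlet_le M f)"

text \<open>The Neumann series converges in the weighted norm although only the sup norm of
  \<open>g\<close> is known to be small. Any rate strictly between 1/2 and 1 would do in place of
  3/4.\<close>

lemma dirichlet_inverse_one_minus:
  assumes g: "dirichlet g" and bd: "\<And>s. s \<in> H \<Longrightarrow> norm (g s) \<le> 1 / 2"
  shows "dirichlet (\<lambda>s. 1 / (1 - g s))"
proof -
  obtain M where M: "dirichlet_le M g" using g by (auto simp: dirichlet_def)
  have "\<exists>C. \<forall>n. dirichlet_le (C * (3 / 4) ^ n) (\<lambda>s. g s ^ n)"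
    by (rule dirichlet_le_power_sup[OF M bd]) auto
  then obtain C where C: "\<And>n. dirichlet_le (C * (3 / 4) ^ n) (\<lambda>s. g s ^ n)" by blast
  have "summable (\<lambda>n. C * (3 / 4) ^ n)" by (intro summable_mult summable_geometric) auto
  from dirichlet_le_suminf[where f = "\<lambda>n s. g s ^ n", OF C this]
  have "dirichlet_le (\<Sum>n. C * (3 / 4) ^ n) (\<lambda>s. 1 / (1 - g s))"
  proof (rule dirichlet_le_cong)
    show "(\<Sum>n. g s ^ n) = 1 / (1 - g s)" if "s \<in> H" for s
      using bd[OF that] by (intro suminf_geometric) auto
  qed
  then show ?thesis by (auto simp: dirichlet_def)
qed

lemma dirichlet_mult: "dirichlet f \<Longrightarrow> dirichlet g \<Longrightarrow> dirichlet (\<lambda>s. f s * g s)"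
  unfolding dirichlet_def by (blast intro: dirichlet_le_mult)

lemma dirichlet_add: "dirichlet f \<Longrightarrow> dirichlet g \<Longrightarrow> dirichlet (\<lambda>s. f s + g s)"
  unfolding dirichlet_def by (blast intro: dirichlet_le_add)

lemma dirichlet_const: "dirichlet (\<lambda>s. a)"
  unfolding dirichlet_def by (blast intro: dirichlet_le_const)

lemma dirichlet_diff: "dirichlet f \<Longrightarrow> dirichlet g \<Longrightarrow> dirichlet (\<lambda>s. f s - g s)"
  using dirichlet_add[of f "\<lambda>s. -1 * g s"] dirichlet_mult[OF dirichlet_const[of "-1"], of g] by simp

text \<open>With \<open>k\<close> inverse to \<open>h\<close>, one has
  \<open>h' * k = 1 - k * (h - h')\<close>, and the right-hand side is inverted by the Neumann
  series. The closeness condition involves only sup norms.\<close>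

lemma invertible_perturbation:
  assumes "dirichlet h" "dirichlet k" "dirichlet h'" and hk: "\<And>s. s \<in> H \<Longrightarrow> h s * k s = 1"
    and close: "\<And>s. s \<in> H \<Longrightarrow> norm (k s * (h s - h' s)) \<le> 1 / 2"
  shows "\<exists>k'. dirichlet k' \<and> (\<forall>s\<in>H. h' s * k' s = 1)"
proof (intro exI conjI ballI)
  have "dirichlet (\<lambda>s. k s * (h s - h' s))"
    by (intro dirichlet_mult dirichlet_diff assms)
  from dirichlet_inverse_one_minus[OF this close]
  show "dirichlet (\<lambda>s. k s * (1 / (1 - k s * (h s - h' s))))"
    using dirichlet_mult assms(2) by blast
  fix s assume s: "s \<in> H"
  have "1 - k s * (h s - h' s) = h' s * k s" using hk[OF s] by (simp add: algebra_simps)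
  moreover have "1 - k s * (h s - h' s) \<noteq> 0" using close[OF s] by auto
  ultimately show "h' s * (k s * (1 / (1 - k s * (h s - h' s)))) = 1" by auto
qed

subsection \<open>Shifts and inversion of scalar series\<close>

lemma shift_in_half_plane: "s \<in> H \<Longrightarrow> 0 \<le> t \<Longrightarrow> s + of_real t \<in> H"
  by (simp add: right_half_plane_def)

text \<open>The shift multiplies the coefficient at \<open>l\<close> by
  \<open>exp (- l * t)\<close>, which has modulus at most 1 because \<open>t\<close> is
  nonnegative.\<close>

lemma dirichlet_shift:
  assumes "dirichlet f" and t: "0 \<le> t"
  shows "dirichlet (\<lambda>s. f (s + of_real t))"
proof -
  obtain c S where c: "((\<lambda>l. norm (c l) * \<omega> l) has_sum S) \<Lambda>"
    and f: "\<And>s. s \<in> H \<Longrightarrow> ((\<lambda>l. c l * exp (- (of_real l) * s)) has_sum f s) \<Lambda>"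
    using assms unfolding dirichlet_def dirichlet_le_def by blast
  have tH: "of_real t \<in> H" using t by (simp add: right_half_plane_def)
  have "dirichlet_le S (\<lambda>s. f (s + of_real t))"
  proof (rule dirichlet_le_regroup[where J = \<Lambda> and l = "\<lambda>l. l" and a = "\<lambda>l. c l * exp (- (of_real l) * of_real t)"])
    show "((\<lambda>l. norm (c l) * \<omega> l) has_sum S) \<Lambda>" by fact
    show "norm (c l * exp (- (of_real l) * of_real t)) * \<omega> l \<le> norm (c l) * \<omega> l" if "l \<in> \<Lambda>" for l
      using norm_term_le[OF that tH, of "c l"] weight_ge_1[OF that] by (intro mult_right_mono) auto
    show "((\<lambda>l. c l * exp (- (of_real l) * of_real t) * exp (- (of_real l) * s)) has_sum f (s + of_real t)) \<Lambda>"
      if "s \<in> H" for s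
      using f[OF shift_in_half_plane[OF that t]] by (simp add: exp_add ring_distribs mult_ac exp_diff exp_minus divide_simps)
  qed
  then show ?thesis by (auto simp: dirichlet_def)
qed

text \<open>Shifting changes the coefficients of the finite part by factors
  \<open>exp (- l * \<eta>) - 1\<close>, which are small uniformly in \<open>s\<close>. This costs
  one third of \<open>\<epsilon>\<close>; the remainder, evaluated at two points, costs the other
  two.\<close>

lemma dirichlet_small_shift:
  assumes "dirichlet f" and \<epsilon>: "0 < \<epsilon>"
  shows "\<exists>\<eta>>0. \<forall>s\<in>H. norm (f (s + of_real \<eta>) - f s) \<le> \<epsilon>"
proof -
  obtain M where M: "dirichlet_le M f" using assms(1) by (auto simp: dirichlet_def)
  have "0 < \<epsilon> / 3" using \<epsilon> by simp
  then obtain F a q where F: "finite F" "F \<subseteq> \<Lambda>" and q: "dirichlet_le (\<epsilon> / 3) q"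
    and f_eq: "\<And>s. f s = (\<Sum>l\<in>F. a l * exp (- (of_real l) * s)) + q s"
    by (rule dirichlet_le_split[OF M]) (rule that)
  define d where "d \<eta> = (\<Sum>l\<in>F. norm (a l) * norm (exp (- of_real l * of_real \<eta>) - (1 :: complex)))" for \<eta> :: real
  have "(d \<longlongrightarrow> (\<Sum>l\<in>F. norm (a l) * norm (exp (- of_real l * of_real 0) - (1 :: complex)))) (at_right 0)"
    unfolding d_def by (intro tendsto_intros)
  then have "\<forall>\<^sub>F \<eta> in at_right 0. d \<eta> < \<epsilon> / 3"
    by (rule order_tendstoD) (use \<epsilon> in simp)
  then have "\<forall>\<^sub>F \<eta> in at_right 0. d \<eta> < \<epsilon> / 3 \<and> 0 < \<eta>"
    using eventually_at_right_less[of 0] by (rule eventually_conj)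
  then obtain \<eta> where \<eta>: "d \<eta> < \<epsilon> / 3" "0 < \<eta>"
    using eventually_happens[of _ "at_right (0::real)"] by fastforce
  have "norm (f (s + of_real \<eta>) - f s) \<le> \<epsilon>" if s: "s \<in> H" for s
  proof -
    define P where "P = (\<Sum>l\<in>F. (a l * (exp (- of_real l * of_real \<eta>) - 1)) * exp (- (of_real l) * s))"
    have "a l * exp (- (of_real l) * (s + of_real \<eta>)) - a l * exp (- (of_real l) * s)
        = (a l * (exp (- of_real l * of_real \<eta>) - 1)) * exp (- (of_real l) * s)" for l
      by (simp add: distrib_left exp_add right_diff_distrib left_diff_distrib exp_diff exp_minus field_simps)
    then have "f (s + of_real \<eta>) - f s = P + (q (s + of_real \<eta>) - q s)"
      unfolding f_eq P_def by (simp only: add_diff_add sum_subtractf[symmetric])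
    moreover have "norm P \<le> d \<eta>"
      unfolding P_def d_def
      by (intro sum_norm_le order_trans[OF norm_term_le[OF _ s]]) (use F in \<open>auto simp: norm_mult\<close>)
    moreover have "norm (q (s + of_real \<eta>) - q s) \<le> \<epsilon> / 3 + \<epsilon> / 3"
      using \<eta> by (intro order_trans[OF norm_triangle_ineq4] add_mono dirichlet_le_bound[OF q] shift_in_half_plane s) auto
    ultimately show ?thesis
      using \<eta>(1) norm_triangle_ineq[of P "q (s + of_real \<eta>) - q s"] by simp
  qed
  then show ?thesis using \<eta>(2) by blast
qed

text \<open>In the finite part every term of positive frequency decays as \<open>t\<close> grows,
  uniformly in \<open>s\<close>, which leaves the constant term. The constant may depend on
  \<open>\<epsilon>\<close> through the choice of that finite part.\<close>

lemma dirichlet_large_shift: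
  assumes "dirichlet f" and \<epsilon>: "0 < \<epsilon>"
  shows "\<exists>c. \<forall>\<^sub>F t in at_top. \<forall>s\<in>H. norm (f (s + of_real t) - c) \<le> \<epsilon>"
proof -
  obtain M where M: "dirichlet_le M f" using assms(1) by (auto simp: dirichlet_def)
  have "0 < \<epsilon> / 2" using \<epsilon> by simp
  then obtain F a q where F: "finite F" "F \<subseteq> \<Lambda>" and q: "dirichlet_le (\<epsilon> / 2) q"
    and f_eq: "\<And>s. f s = (\<Sum>l\<in>F. a l * exp (- (of_real l) * s)) + q s"
    by (rule dirichlet_le_split[OF M]) (rule that)
  \<comment> \<open>The frequency 0 need not occur in \<open>F\<close>; the finite part then has
    constant term 0.\<close>
  define c where "c = (if 0 \<in> F then a 0 else 0)"
  define d where "d t = (\<Sum>l\<in>F-{0}. norm (a l) * exp (- l * t))" for t :: real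
  have "((\<lambda>t. exp (- l * t)) \<longlongrightarrow> 0) at_top" if "l \<in> F - {0}" for l :: real
  proof -
    have "0 < l" using that F(2) nonneg by force
    then have "filterlim (\<lambda>t. l * t) at_top at_top"
      by (intro filterlim_tendsto_pos_mult_at_top[OF tendsto_const _ filterlim_ident])
    then have "filterlim (\<lambda>t. - l * t) at_bot at_top"
      by (simp add: filterlim_uminus_at_bot)
    then show ?thesis by (rule filterlim_compose[OF exp_at_bot])
  qed
  then have "(d \<longlongrightarrow> (\<Sum>l\<in>F-{0}. norm (a l) * 0)) at_top"
    unfolding d_def by (intro tendsto_sum tendsto_mult tendsto_const)
  then have "\<forall>\<^sub>F t in at_top. d t < \<epsilon> / 2"
    by (rule order_tendstoD) (use \<epsilon> in simp)
  then have "\<forall>\<^sub>F t in at_top. \<forall>s\<in>H. norm (f (s + of_real t) - c) \<le> \<epsilon>"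
    using eventually_ge_at_top[of 0]
  proof eventually_elim
    case (elim t)
    show ?case
    proof
      fix s assume s: "s \<in> H"
      note sH = shift_in_half_plane[OF s elim(2)]
      define P where "P = (\<Sum>l\<in>F-{0}. (a l * exp (- of_real l * of_real t)) * exp (- of_real l * s))"
      have "(\<Sum>l\<in>F. a l * exp (- (of_real l) * (s + of_real t))) = c + (\<Sum>l\<in>F-{0}. a l * exp (- (of_real l) * (s + of_real t)))"
        using F(1) by (auto simp: c_def sum.remove)
      also have "(\<Sum>l\<in>F-{0}. a l * exp (- (of_real l) * (s + of_real t))) = P"
        unfolding P_def by (intro sum.cong) (auto simp: ring_distribs exp_diff exp_minus field_simps)
      finally have "f (s + of_real t) - c = P + q (s + of_real t)" by (simp add: f_eq)
      moreover have "norm P \<le> d t"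
        unfolding P_def d_def
        by (intro sum_norm_le order_trans[OF norm_term_le[OF _ s]]) (use F in \<open>auto simp: norm_mult\<close>)
      ultimately show "norm (f (s + of_real t) - c) \<le> \<epsilon>"
        using norm_triangle_ineq[of P "q (s + of_real t)"] dirichlet_le_bound[OF q sH] elim(1) by simp
    qed
  qed
  then show ?thesis by blast
qed

text \<open>A shift to the right keeps \<open>H\<close> inside itself, so all shifts share the lower
  bound \<open>\<delta>\<close>. Their inverses are therefore bounded by
  \<open>1 / \<delta>\<close>, and one step length serves throughout.\<close>

lemma dirichlet_inverse:
  assumes f: "dirichlet f" and \<delta>: "0 < \<delta>" and bd: "\<And>s. s \<in> H \<Longrightarrow> \<delta> \<le> norm (f s)"
  shows "\<exists>g. dirichlet g \<and> (\<forall>s\<in>H. f s * g s = 1)"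
proof -
  define f' where "f' n \<eta> s = f (s + of_real (real n * \<eta>))" for n \<eta> s
  define inv where "inv h \<longleftrightarrow> (\<exists>g. dirichlet g \<and> (\<forall>s\<in>H. h s * g s = 1))" for h
  obtain \<eta> where \<eta>: "0 < \<eta>" and step: "\<And>s. s \<in> H \<Longrightarrow> norm (f (s + of_real \<eta>) - f s) \<le> \<delta> / 2"
    using dirichlet_small_shift[OF f, of "\<delta> / 2"] \<delta> by auto
  obtain c where "\<forall>\<^sub>F t in at_top. \<forall>s\<in>H. norm (f (s + of_real t) - c) \<le> \<delta> / 4"
    using dirichlet_large_shift[OF f, of "\<delta> / 4"] \<delta> by auto
  then obtain T where T: "\<And>t s. T \<le> t \<Longrightarrow> s \<in> H \<Longrightarrow> norm (f (s + of_real t) - c) \<le> \<delta> / 4"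
    by (auto simp: eventually_at_top_linorder)
  obtain N :: nat where N: "T \<le> real N * \<eta>"
    using reals_Archimedean3[OF \<eta>] less_imp_le by blast
  have in_H: "s + of_real (real n * \<eta>) \<in> H" if "s \<in> H" for s n
    using \<eta> by (intro shift_in_half_plane[OF that]) simp
  have dir: "dirichlet (f' n \<eta>)" for n
    unfolding f'_def using \<eta> by (intro dirichlet_shift[OF f]) simp
  \<comment> \<open>far to the right \<open>f\<close> is close to a nonzero constant; from there invertibility is carried
    back to the imaginary axis in steps of length \<open>\<eta>\<close>\<close>
  have "inv (f' N \<eta>)"
  proof -
    have close: "norm (f' N \<eta> s - c) \<le> \<delta> / 4" if "s \<in> H" for s
      unfolding f'_def by (rule T[OF N that])
    \<comment> \<open>The tolerance \<open>\<delta> / 4\<close> leaves at least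
      \<open>3 * \<delta> / 4\<close> for the constant, so the distance to \<open>c\<close> is at
      most half of \<open>norm c\<close>.\<close>
    have c: "3 * \<delta> / 4 \<le> norm c"
      using close[of 0] bd[OF in_H[of 0 N]] norm_triangle_ineq2[of "f' N \<eta> 0" c]
      by (auto simp: f'_def right_half_plane_def)
    have "norm (1 / c * (c - f' N \<eta> s)) \<le> 1 / 2" if "s \<in> H" for s
    proof -
      have "norm (c - f' N \<eta> s) \<le> norm c / 2"
        using close[OF that] c \<delta> by (simp add: norm_minus_commute)
      moreover have "0 < norm c" using c \<delta> by linarith
      ultimately show ?thesis by (simp add: norm_mult norm_divide divide_le_eq)
    qed
    moreover have "c \<noteq> 0" using c \<delta> by auto
    ultimately show ?thesis
      unfolding inv_def
      by (intro invertible_perturbation[of "\<lambda>_. c" "\<lambda>_. 1 / c"] dirichlet_const dir) auto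
  qed
  moreover have "inv (f' n \<eta>)" if suc: "inv (f' (Suc n) \<eta>)" for n
  proof -
    obtain k where k: "dirichlet k" "\<And>s. s \<in> H \<Longrightarrow> f' (Suc n) \<eta> s * k s = 1"
      using suc unfolding inv_def by blast
    \<comment> \<open>The inverse has modulus at most \<open>1 / \<delta>\<close> and a step changes
      the value by at most \<open>\<delta> / 2\<close>.\<close>
    have "norm (k s * (f' (Suc n) \<eta> s - f' n \<eta> s)) \<le> 1 / 2" if s: "s \<in> H" for s
    proof -
      have "norm (f' (Suc n) \<eta> s) * norm (k s) = 1" using k(2)[OF s] by (metis norm_mult norm_one)
      then have "\<delta> * norm (k s) \<le> 1"
        using bd[OF in_H[OF s, of "Suc n"]] mult_right_mono[of \<delta> "norm (f' (Suc n) \<eta> s)" "norm (k s)"]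
        by (simp add: f'_def del: of_nat_Suc)
      moreover have "norm (f' (Suc n) \<eta> s - f' n \<eta> s) \<le> \<delta> / 2"
        using step[OF in_H[OF s, of n]] by (simp add: f'_def algebra_simps)
      ultimately show ?thesis
        using mult_left_mono[of "norm (f' (Suc n) \<eta> s - f' n \<eta> s)" "\<delta> / 2" "norm (k s)"]
        by (simp add: norm_mult mult.commute)
    qed
    then show ?thesis
      unfolding inv_def by (intro invertible_perturbation[OF dir k(1) dir k(2)])
  qed
  ultimately have "inv (f' 0 \<eta>)"
    by (induction N) auto
  then show ?thesis by (simp add: inv_def f'_def)
qed

end

subsection \<open>Matrices\<close>

lemma bounded_linear_matrix_vector_mult:
  fixes A :: "complex^'n^'m"
  shows "bounded_linear ((*v) A)"
  unfolding linear_conv_bounded_linear[symmetric]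
  by (rule linearI)
    (auto simp: vec_eq_iff matrix_vector_mult_def distrib_left sum.distrib scaleR_sum_right)

lemma norm_vec_le_sum_norm: "norm x \<le> (\<Sum>i\<in>UNIV. norm (x $ i))"
  unfolding norm_vec_def by (rule L2_set_le_sum) auto

text \<open>An entry is a coordinate of the image of a unit vector. With the reverse estimate by the
  sum of all entries, weighted summability of matrices becomes a condition on the entries.\<close>

lemma norm_entry_le_onorm:
  fixes A :: "complex^'n^'m"
  shows "norm (A $ i $ j) \<le> onorm ((*v) A)"
proof -
  have "norm (A $ i $ j) = norm ((A *v axis j 1) $ i)"
    by (simp add: matrix_vector_mult_def axis_def if_distrib cong: if_cong)
  also have "\<dots> \<le> norm (A *v axis j 1)" by (rule Finite_Cartesian_Product.norm_nth_le)
  also have "\<dots> \<le> onorm ((*v) A) * norm (axis j (1 :: complex) :: complex^'n)"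
    by (rule onorm[OF bounded_linear_matrix_vector_mult])
  finally show ?thesis by simp
qed

lemma onorm_le_sum_norm_entries:
  fixes A :: "complex^'n^'m"
  shows "onorm ((*v) A) \<le> (\<Sum>i\<in>UNIV. \<Sum>j\<in>UNIV. norm (A $ i $ j))"
proof (rule onorm_le)
  fix x :: "complex^'n"
  have "norm (A *v x) \<le> (\<Sum>i\<in>UNIV. norm ((A *v x) $ i))" by (rule norm_vec_le_sum_norm)
  also have "\<dots> \<le> (\<Sum>i\<in>UNIV. \<Sum>j\<in>UNIV. norm (A $ i $ j) * norm x)"
    unfolding matrix_vector_mult_def
    by (auto intro!: sum_mono sum_norm_le mult_left_mono Finite_Cartesian_Product.norm_nth_le simp: norm_mult)
  finally show "norm (A *v x) \<le> (\<Sum>i\<in>UNIV. \<Sum>j\<in>UNIV. norm (A $ i $ j)) * norm x"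
    by (simp add: sum_distrib_right)
qed

lemma has_sum_vec:
  fixes f :: "'a \<Rightarrow> ('b::{comm_monoid_add,topological_space})^'n"
  assumes "\<And>i. ((\<lambda>x. f x $ i) has_sum S $ i) X"
  shows "(f has_sum S) X"
  using assms unfolding has_sum_def by (auto intro!: vec_tendstoI)

lemma has_sum_prod:
  fixes f :: "'a \<Rightarrow> 'b::{comm_monoid_add,topological_space} \<times> 'c::{comm_monoid_add,topological_space}"
  assumes "((\<lambda>x. fst (f x)) has_sum fst S) X" "((\<lambda>x. snd (f x)) has_sum snd S) X"
  shows "(f has_sum S) X"
proof -
  have "sum f = (\<lambda>F. (sum (\<lambda>x. fst (f x)) F, sum (\<lambda>x. snd (f x)) F))"
    by (simp add: fun_eq_iff prod_eq_iff fst_sum snd_sum)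
  then show ?thesis using tendsto_Pair[OF assms[unfolded has_sum_def]] by (simp add: has_sum_def)
qed

lemma summable_on_sum:
  fixes f :: "'i \<Rightarrow> 'a \<Rightarrow> 'b::topological_comm_monoid_add"
  assumes "finite I" "\<And>i. i \<in> I \<Longrightarrow> f i summable_on X"
  shows "(\<lambda>x. \<Sum>i\<in>I. f i x) summable_on X"
  using assms by (induction I rule: finite_induct) (auto intro: summable_on_add)

lemma continuous_on_det:
  "continuous_on X (det :: complex^'n^'n \<Rightarrow> complex)"
  unfolding det_def by (intro continuous_intros)

lemma GL_bc_iff: "M \<in> GL_bc \<longleftrightarrow> det (fst M) \<noteq> 0 \<and> det (snd M) \<noteq> 0"
proof -
  have "M \<in> GL_bc \<longleftrightarrow> invertible (fst M) \<and> invertible (snd M)"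
    unfolding GL_bc_def bc_mult_def bc_one_def invertible_def by force
  then show ?thesis by (simp add: invertible_det_nz)
qed

section \<open>Matrix-valued Dirichlet series\<close>

context weighted_semigroup
begin

lemma dirichlet_sum:
  "finite I \<Longrightarrow> (\<And>i. i \<in> I \<Longrightarrow> dirichlet (f i)) \<Longrightarrow> dirichlet (\<lambda>s. \<Sum>i\<in>I. f i s)"
  by (induction I rule: finite_induct) (simp_all add: dirichlet_const dirichlet_add)

lemma dirichlet_prod:
  "finite I \<Longrightarrow> (\<And>i. i \<in> I \<Longrightarrow> dirichlet (f i)) \<Longrightarrow> dirichlet (\<lambda>s. \<Prod>i\<in>I. f i s)"
  by (induction I rule: finite_induct) (simp_all add: dirichlet_const dirichlet_mult)

lemma dirichlet_det:
  fixes A :: "complex \<Rightarrow> complex^'n^'n"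
  assumes "\<And>i j. dirichlet (\<lambda>s. A s $ i $ j)"
  shows "dirichlet (\<lambda>s. det (A s))"
  unfolding det_def by (intro dirichlet_sum dirichlet_mult dirichlet_const dirichlet_prod assms) auto

lemma dirichlet_bounded:
  assumes "dirichlet f"
  obtains M where "\<And>s. s \<in> H \<Longrightarrow> norm (f s) \<le> M"
  using assms dirichlet_le_bound unfolding dirichlet_def by blast

lemma dirichlet_matrix_inverse:
  fixes A :: "complex \<Rightarrow> complex^'n^'n"
  assumes A: "\<And>i j. dirichlet (\<lambda>s. A s $ i $ j)"
    and \<delta>: "0 < \<delta>" "\<And>s. s \<in> H \<Longrightarrow> \<delta> \<le> norm (det (A s))"
  shows "\<exists>B. (\<forall>i j. dirichlet (\<lambda>s. B s $ i $ j)) \<and> (\<forall>s\<in>H. A s ** B s = mat 1)"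
proof -
  obtain g where g: "dirichlet g" and dg: "\<And>s. s \<in> H \<Longrightarrow> det (A s) * g s = 1"
    using dirichlet_inverse[OF dirichlet_det[OF A] \<delta>] by blast
  \<comment> \<open>\<open>D i j s\<close> is \<open>A s\<close> with column \<open>i\<close>
    replaced by the \<open>j\<close>-th unit vector. Its determinant is an entry of the adjugate, so
    \<open>B\<close> is the inverse given by Cramer's rule.\<close>
  define D :: "'n \<Rightarrow> 'n \<Rightarrow> complex \<Rightarrow> complex^'n^'n" where
    "D i j s = (\<chi> k l. if l = i then mat 1 $ k $ j else A s $ k $ l)" for i j s
  define B :: "complex \<Rightarrow> complex^'n^'n" where "B s = (\<chi> i j. det (D i j s) * g s)" for s
  have "dirichlet (\<lambda>s. D i j s $ k $ l)" for i j k l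
    by (cases "l = i") (simp_all add: D_def A dirichlet_const)
  then have "dirichlet (\<lambda>s. B s $ i $ j)" for i j
    unfolding B_def by (simp add: dirichlet_mult dirichlet_det g)
  moreover have "A s ** B s = mat 1" if s: "s \<in> H" for s
  proof -
    have d0: "det (A s) \<noteq> 0" using \<delta>(1) \<delta>(2)[OF s] by auto
    have gs: "g s = 1 / det (A s)" using dg[OF s] d0 by (simp add: field_simps)
    have "A s *v (\<chi> i. B s $ i $ j) = (\<chi> k. mat 1 $ k $ j)" for j
      unfolding cramer[OF d0] by (simp add: vec_eq_iff B_def D_def gs cong: if_cong)
    then show ?thesis
      by (simp add: vec_eq_iff matrix_matrix_mult_def matrix_vector_mult_def)
  qed
  ultimately show ?thesis by blast
qed

text \<open>The bridge to the scalar theory. Forwards, entries are linear functionals dominated by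
  \<open>bc_norm\<close>; backwards, coefficients are chosen for each entry and assembled into
  matrices.\<close>

lemma in_D_iff_entries:
  fixes f :: "complex \<Rightarrow> 'n::finite bcmat"
  shows "in_D \<Lambda> \<omega> f \<longleftrightarrow>
    (\<forall>i j. dirichlet (\<lambda>s. fst (f s) $ i $ j)) \<and> (\<forall>i j. dirichlet (\<lambda>s. snd (f s) $ i $ j))"
proof
  assume "in_D \<Lambda> \<omega> f"
  then obtain c where c: "(\<lambda>l. bc_norm (c l) * \<omega> l) summable_on \<Lambda>"
    and f: "\<And>s. s \<in> H \<Longrightarrow> ((\<lambda>l. bc_scale (exp (- (of_real l) * s)) (c l)) has_sum f s) \<Lambda>"
    unfolding in_D_def by blast
  \<comment> \<open>Stated for an abstract functional so that the entries of both idempotent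
    components are instances.\<close>
  have entry: "dirichlet (\<lambda>s. \<pi> (f s))"
    if lin: "bounded_linear \<pi>" and le: "\<And>A. norm (\<pi> A) \<le> bc_norm A"
      and scale: "\<And>z A. \<pi> (bc_scale z A) = \<pi> A * z" for \<pi> :: "'n bcmat \<Rightarrow> complex"
  proof -
    have "(\<lambda>l. norm (\<pi> (c l)) * \<omega> l) summable_on \<Lambda>"
      by (rule summable_on_comparison_test[OF c mult_right_mono[OF le weight_nonneg] weighted_norm_nonneg])
    then have "((\<lambda>l. norm (\<pi> (c l)) * \<omega> l) has_sum infsum (\<lambda>l. norm (\<pi> (c l)) * \<omega> l) \<Lambda>) \<Lambda>" by simp
    moreover have "((\<lambda>l. \<pi> (c l) * exp (- (of_real l) * s)) has_sum \<pi> (f s)) \<Lambda>" if "s \<in> H" for s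
      using has_sum_bounded_linear[OF lin f[OF that]] by (simp only: scale o_def)
    ultimately have "dirichlet_le (infsum (\<lambda>l. norm (\<pi> (c l)) * \<omega> l) \<Lambda>) (\<lambda>s. \<pi> (f s))"
      unfolding dirichlet_le_def by (intro exI[of _ "\<lambda>l. \<pi> (c l)"]) auto
    then show ?thesis by (auto simp: dirichlet_def)
  qed
  have pos: "0 \<le> onorm ((*v) A)" for A :: "complex^'n^'n"
    by (rule onorm_pos_le[OF bounded_linear_matrix_vector_mult])
  have "dirichlet (\<lambda>s. fst (f s) $ i $ j)" for i j
  proof (rule entry)
    show "bounded_linear (\<lambda>A :: 'n bcmat. fst A $ i $ j)"
      by (intro bounded_linear_compose[OF bounded_linear_vec_nth] bounded_linear_fst)
    show "norm (fst A $ i $ j) \<le> bc_norm A" for A :: "'n bcmat"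
      using norm_entry_le_onorm[of "fst A" i j] pos[of "snd A"] by (simp add: bc_norm_def)
  qed (simp add: bc_scale_def)
  moreover have "dirichlet (\<lambda>s. snd (f s) $ i $ j)" for i j
  proof (rule entry)
    show "bounded_linear (\<lambda>A :: 'n bcmat. snd A $ i $ j)"
      by (intro bounded_linear_compose[OF bounded_linear_vec_nth] bounded_linear_snd)
    show "norm (snd A $ i $ j) \<le> bc_norm A" for A :: "'n bcmat"
      using norm_entry_le_onorm[of "snd A" i j] pos[of "fst A"] by (simp add: bc_norm_def)
  qed (simp add: bc_scale_def)
  ultimately show "(\<forall>i j. dirichlet (\<lambda>s. fst (f s) $ i $ j)) \<and> (\<forall>i j. dirichlet (\<lambda>s. snd (f s) $ i $ j))"
    by blast
next
  have matrix_coeffs: "\<exists>c :: real \<Rightarrow> complex^'n^'n. (\<lambda>l. onorm ((*v) (c l)) * \<omega> l) summable_on \<Lambda> \<and>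
      (\<forall>s\<in>H. ((\<lambda>l. \<chi> i j. exp (- (of_real l) * s) * c l $ i $ j) has_sum A s) \<Lambda>)"
    if A: "\<forall>i j. dirichlet (\<lambda>s. A s $ i $ j)" for A :: "complex \<Rightarrow> complex^'n^'n"
  proof -
    have "\<forall>p. \<exists>c. (\<lambda>l. norm (c l) * \<omega> l) summable_on \<Lambda> \<and>
        (\<forall>s\<in>H. ((\<lambda>l. c l * exp (- (of_real l) * s)) has_sum A s $ fst p $ snd p) \<Lambda>)"
      using A unfolding dirichlet_def dirichlet_le_def summable_on_def by blast
    then obtain c where c: "\<forall>p. (\<lambda>l. norm (c p l) * \<omega> l) summable_on \<Lambda> \<and>
        (\<forall>s\<in>H. ((\<lambda>l. c p l * exp (- (of_real l) * s)) has_sum A s $ fst p $ snd p) \<Lambda>)"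
      by (rule choice[THEN exE])
    define C :: "real \<Rightarrow> complex^'n^'n" where "C l = (\<chi> i j. c (i, j) l)" for l
    have "(\<lambda>l. onorm ((*v) (C l)) * \<omega> l) summable_on \<Lambda>"
    proof (rule summable_on_comparison_test)
      show "(\<lambda>l. \<Sum>i\<in>UNIV. \<Sum>j\<in>UNIV. norm (c (i, j) l) * \<omega> l) summable_on \<Lambda>"
        using c by (intro summable_on_sum) auto
      fix l assume "l \<in> \<Lambda>"
      then have w: "0 \<le> \<omega> l" by (rule weight_nonneg)
      show "0 \<le> onorm ((*v) (C l)) * \<omega> l"
        using w by (intro mult_nonneg_nonneg onorm_pos_le[OF bounded_linear_matrix_vector_mult])
      show "onorm ((*v) (C l)) * \<omega> l \<le> (\<Sum>i\<in>UNIV. \<Sum>j\<in>UNIV. norm (c (i, j) l) * \<omega> l)"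
        using mult_right_mono[OF onorm_le_sum_norm_entries[of "C l"] w]
        by (simp add: C_def sum_distrib_right)
    qed
    moreover have "((\<lambda>l. \<chi> i j. exp (- (of_real l) * s) * C l $ i $ j) has_sum A s) \<Lambda>" if "s \<in> H" for s
      using c that by (intro has_sum_vec) (auto simp: C_def mult.commute)
    ultimately show ?thesis by blast
  qed
  assume "(\<forall>i j. dirichlet (\<lambda>s. fst (f s) $ i $ j)) \<and> (\<forall>i j. dirichlet (\<lambda>s. snd (f s) $ i $ j))"
  note entries = conjunct1[OF this] conjunct2[OF this]
  obtain c1 :: "real \<Rightarrow> complex^'n^'n" where
    s1: "(\<lambda>l. onorm ((*v) (c1 l)) * \<omega> l) summable_on \<Lambda>" and
    f1: "\<forall>s\<in>H. ((\<lambda>l. \<chi> i j. exp (- (of_real l) * s) * c1 l $ i $ j) has_sum fst (f s)) \<Lambda>"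
    using matrix_coeffs[OF entries(1)] by (elim exE conjE)
  obtain c2 :: "real \<Rightarrow> complex^'n^'n" where
    s2: "(\<lambda>l. onorm ((*v) (c2 l)) * \<omega> l) summable_on \<Lambda>" and
    f2: "\<forall>s\<in>H. ((\<lambda>l. \<chi> i j. exp (- (of_real l) * s) * c2 l $ i $ j) has_sum snd (f s)) \<Lambda>"
    using matrix_coeffs[OF entries(2)] by (elim exE conjE)
  show "in_D \<Lambda> \<omega> f"
    unfolding in_D_def
  proof (intro exI conjI ballI)
    show "(\<lambda>l. bc_norm (c1 l, c2 l) * \<omega> l) summable_on \<Lambda>"
      using summable_on_add[OF s1 s2] by (simp add: bc_norm_def distrib_right)
    show "((\<lambda>l. bc_scale (exp (- complex_of_real l * s)) (c1 l, c2 l)) has_sum f s) \<Lambda>" if "s \<in> H" for s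
      using f1 f2 that by (intro has_sum_prod) (auto simp: bc_scale_def)
  qed
qed

text \<open>Boundedness makes the closure of the range compact, so that \<open>norm (det _)\<close>
  attains a minimum on it.\<close>

lemma bounded_dirichlet_matrix:
  fixes A :: "complex \<Rightarrow> complex^'n^'n"
  assumes "\<And>i j. dirichlet (\<lambda>s. A s $ i $ j)"
  shows "bounded (A ` H)"
proof -
  have "\<forall>p. \<exists>M. \<forall>s\<in>H. norm (A s $ fst p $ snd p) \<le> M"
    using assms dirichlet_le_bound unfolding dirichlet_def by blast
  then obtain M where M: "\<forall>p. \<forall>s\<in>H. norm (A s $ fst p $ snd p) \<le> M p"
    by (rule choice[THEN exE])
  have "norm (A s) \<le> (\<Sum>i\<in>UNIV. \<Sum>j\<in>UNIV. M (i, j))" if "s \<in> H" for s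
    using M that
    by (intro order_trans[OF norm_vec_le_sum_norm] sum_mono) (auto intro!: order_trans[OF norm_vec_le_sum_norm] sum_mono)
  then show ?thesis unfolding bounded_iff by blast
qed

text \<open>The determinants of \<open>A s\<close> and \<open>B s\<close> multiply to 1, and that of
  \<open>B s\<close> is a scalar series, hence bounded on \<open>H\<close>.\<close>

lemma det_bounded_below:
  fixes A B :: "complex \<Rightarrow> complex^'n^'n"
  assumes "\<And>i j. dirichlet (\<lambda>s. B s $ i $ j)" and AB: "\<And>s. s \<in> H \<Longrightarrow> A s ** B s = mat 1"
  shows "\<exists>\<delta>>0. \<forall>s\<in>H. \<delta> \<le> norm (det (A s))"
proof -
  obtain M where M: "\<And>s. s \<in> H \<Longrightarrow> norm (det (B s)) \<le> M"
    using dirichlet_bounded[OF dirichlet_det[OF assms(1)]] by blast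
  have "1 / (\<bar>M\<bar> + 1) \<le> norm (det (A s))" if s: "s \<in> H" for s
  proof -
    have "norm (det (A s)) * norm (det (B s)) = 1"
      using AB[OF s] by (metis det_I det_mul norm_mult norm_one)
    moreover have "norm (det (A s)) * norm (det (B s)) \<le> norm (det (A s)) * (\<bar>M\<bar> + 1)"
      using M[OF s] by (intro mult_left_mono) auto
    ultimately show ?thesis by (simp add: divide_le_eq)
  qed
  then show ?thesis by (intro exI[of _ "1 / (\<bar>M\<bar> + 1)"]) auto
qed

end

section \<open>The inversion criterion for bicomplex matrices\<close>

theorem mainTheorem7:
  fixes \<Lambda> :: "real set" and \<omega> :: "real \<Rightarrow> real"
    and f :: "complex \<Rightarrow> 'n::finite bcmat"
  assumes "\<Lambda> \<subseteq> {0..}" and "0 \<in> \<Lambda>"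
    and "\<forall>a\<in>\<Lambda>. \<forall>b\<in>\<Lambda>. a + b \<in> \<Lambda>"
    and "admissible_weight \<Lambda> \<omega>"
    and "in_D \<Lambda> \<omega> f"
  shows "(\<exists>g. in_D \<Lambda> \<omega> g \<and>
            (\<forall>s\<in>right_half_plane. bc_mult (f s) (g s) = bc_one \<and> bc_mult (g s) (f s) = bc_one))
         \<longleftrightarrow> closure (f ` right_half_plane) \<subseteq> GL_bc"
proof -
  interpret weighted_semigroup \<Lambda> \<omega>
    using assms by unfold_locales auto
  have f1: "\<And>i j. dirichlet (\<lambda>s. fst (f s) $ i $ j)" and f2: "\<And>i j. dirichlet (\<lambda>s. snd (f s) $ i $ j)"
    using assms(5) in_D_iff_entries by blast+
  have cont1: "continuous_on X (\<lambda>M :: 'n bcmat. norm (det (fst M)))" for X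
    by (intro continuous_on_norm continuous_on_compose2[OF continuous_on_det[of UNIV]] continuous_on_fst continuous_on_id) auto
  have cont2: "continuous_on X (\<lambda>M :: 'n bcmat. norm (det (snd M)))" for X
    by (intro continuous_on_norm continuous_on_compose2[OF continuous_on_det[of UNIV]] continuous_on_snd continuous_on_id) auto
  show ?thesis
  proof
    assume "\<exists>g. in_D \<Lambda> \<omega> g \<and>
            (\<forall>s\<in>H. bc_mult (f s) (g s) = bc_one \<and> bc_mult (g s) (f s) = bc_one)"
    then obtain g where "in_D \<Lambda> \<omega> g" and fg: "\<And>s. s \<in> H \<Longrightarrow> bc_mult (f s) (g s) = bc_one"
      by blast
    then have g: "\<And>i j. dirichlet (\<lambda>s. fst (g s) $ i $ j)" "\<And>i j. dirichlet (\<lambda>s. snd (g s) $ i $ j)"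
      using in_D_iff_entries by blast+
    obtain \<delta>1 where \<delta>1: "\<delta>1 > 0" "\<And>s. s \<in> H \<Longrightarrow> \<delta>1 \<le> norm (det (fst (f s)))"
      using det_bounded_below[OF g(1), of "\<lambda>s. fst (f s)"] fg by (auto simp: bc_mult_def bc_one_def)
    obtain \<delta>2 where \<delta>2: "\<delta>2 > 0" "\<And>s. s \<in> H \<Longrightarrow> \<delta>2 \<le> norm (det (snd (f s)))"
      using det_bounded_below[OF g(2), of "\<lambda>s. snd (f s)"] fg by (auto simp: bc_mult_def bc_one_def)
    \<comment> \<open>A uniform lower bound on the determinants is a closed condition, so it
      survives the passage to the closure.\<close>
    have "closure (f ` H) \<subseteq> {M. \<delta>1 \<le> norm (det (fst M))} \<inter> {M. \<delta>2 \<le> norm (det (snd M))}"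
      by (intro closure_minimal closed_Int closed_Collect_le continuous_on_const cont1 cont2)
        (use \<delta>1 \<delta>2 in auto)
    then show "closure (f ` H) \<subseteq> GL_bc"
      using \<delta>1(1) \<delta>2(1) by (force simp: GL_bc_iff)
  next
    assume GL: "closure (f ` H) \<subseteq> GL_bc"
    have "f ` H \<subseteq> ((\<lambda>s. fst (f s)) ` H) \<times> ((\<lambda>s. snd (f s)) ` H)"
      by (simp add: image_subset_iff mem_Times_iff)
    then have "bounded (f ` H)"
      using bounded_dirichlet_matrix[OF f1] bounded_dirichlet_matrix[OF f2] bounded_Times bounded_subset by blast
    then have cpt: "compact (closure (f ` H))" by (simp add: compact_closure)
    have "0 \<in> H" by (simp add: right_half_plane_def)
    then have ne: "closure (f ` H) \<noteq> {}" by auto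
    have sub: "f s \<in> closure (f ` H)" if "s \<in> H" for s
      by (intro subsetD[OF closure_subset] imageI that)
    \<comment> \<open>The minimum over the compact closure is attained at an invertible matrix. It
      is therefore positive and serves as the uniform lower bound that scalar inversion
      requires.\<close>
    obtain M1 where M1: "M1 \<in> closure (f ` H)"
      "\<And>M. M \<in> closure (f ` H) \<Longrightarrow> norm (det (fst M1)) \<le> norm (det (fst M))"
      using continuous_attains_inf[OF cpt ne cont1] by blast
    obtain M2 where M2: "M2 \<in> closure (f ` H)"
      "\<And>M. M \<in> closure (f ` H) \<Longrightarrow> norm (det (snd M2)) \<le> norm (det (snd M))"
      using continuous_attains_inf[OF cpt ne cont2] by blast
    have pos: "0 < norm (det (fst M1))" "0 < norm (det (snd M2))"
      using subsetD[OF GL M1(1)] subsetD[OF GL M2(1)] by (simp_all add: GL_bc_iff)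
    obtain B1 where B1: "\<And>i j. dirichlet (\<lambda>s. B1 s $ i $ j)" "\<And>s. s \<in> H \<Longrightarrow> fst (f s) ** B1 s = mat 1"
      using dirichlet_matrix_inverse[OF f1 pos(1) M1(2)[OF sub]] by blast
    obtain B2 where B2: "\<And>i j. dirichlet (\<lambda>s. B2 s $ i $ j)" "\<And>s. s \<in> H \<Longrightarrow> snd (f s) ** B2 s = mat 1"
      using dirichlet_matrix_inverse[OF f2 pos(2) M2(2)[OF sub]] by blast
    have "in_D \<Lambda> \<omega> (\<lambda>s. (B1 s, B2 s))" using B1(1) B2(1) by (simp add: in_D_iff_entries)
    \<comment> \<open>For square matrices a right inverse is also a left inverse.\<close>
    moreover have "bc_mult (f s) (B1 s, B2 s) = bc_one \<and> bc_mult (B1 s, B2 s) (f s) = bc_one" if "s \<in> H" for s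
      using B1(2)[OF that] B2(2)[OF that] by (simp add: bc_mult_def bc_one_def matrix_left_right_inverse1)
    ultimately show "\<exists>g. in_D \<Lambda> \<omega> g \<and>
            (\<forall>s\<in>H. bc_mult (f s) (g s) = bc_one \<and> bc_mult (g s) (f s) = bc_one)" by blast
  qed
qed

end
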